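(* Let $f\in L^1(\mathbb C_+)$. If $f$ satisfies the two conditions $$\int_{\mathbb C_+} f\,dV =0\qquad\text{and}\qquad \int_{\mathbb C_+} |f(z)|\left(\ln_+\left((\Im m\, z)^{-1}\right)+\ln_+(|z|)\right) dV(z) <\infty,$$ then $Pf$ (respectively $P^+f$) is an integrable function on $\mathbb C_+$. Conversely, let $f\in L^1(\mathbb C_+)$ be a function which is non negative outside a compact subset of $\mathbb C_+$. If $P^+f$ belongs to $L^1(\mathbb C_+)$, then $f$ satisfies both of the conditions $$\int_{\mathbb C_+} f\,dV =0\qquad\text{and}\qquad \int_{\mathbb C_+} |f(z)|\left(\ln_+\left((\Im m\, z)^{-1}\right)+\ln_+(|z|)\right) dV(z) <\infty.$$
   Context: $\mathbb C_+=\{z\in\mathbb C:\Im m(z)>0\}$ with Lebesgue measure $dV(z)=dx\,dy$, $z=x+iy$; $L^1(\mathbb C_+)$ is with respect to $dV$. $\ln_+(t)=\max(\ln t,0)$ for $t>0$ (and $\ln_+(0)=0$). $P$ is the Bergman projection, i.e. the orthogonal projection from $L^2(\mathbb C_+)$ onto its subspace of holomorphic functions, given by the integral operator $Pf(z)=\int_{\mathbb C_+}K(z,\zeta)f(\zeta)\,dV(\zeta)$ with kernel $K(z,\zeta)=-\frac{1}{\pi(z-\overline\zeta)^2}$; since $K(z,\cdot)$ is bounded for each fixed $z$, $Pf$ is defined by this formula for $f\in L^1(\mathbb C_+)$. $P^+$ is the integral operator with kernel $|K(z,\zeta)|$: $P^+f(z)=\int_{\mathbb C_+}|K(z,\zeta)|f(\zeta)\,dV(\zeta)$.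 *)

theory Defs
  imports "HOL-Analysis.Analysis"
begin

definition upper_half_plane :: "complex set" where
  "upper_half_plane = {z. Im z > 0}"

definition ln_plus :: "real \<Rightarrow> real" where
  "ln_plus t = (if t > 0 then max (ln t) 0 else 0)"

definition bergman_kernel :: "complex \<Rightarrow> complex \<Rightarrow> complex" where
  "bergman_kernel z w = - (1 / (of_real pi * (z - cnj w)\<^sup>2))"

text \<open>
  For \<open>Im z > 0\<close> the kernel is bounded in its second argument by
  \<open>1 / (pi * (Im z)\<^sup>2)\<close> on the upper half-plane, so for integrable \<open>f\<close> the two Bochner
  integrals below exist at every point of the upper half-plane. Only the values there matter.
\<close>

definition bergman_proj :: "(complex \<Rightarrow> complex) \<Rightarrow> complex \<Rightarrow> complex" where
  "bergman_proj f z = (LINT w:upper_half_plane|lebesgue. bergman_kernel z w * f w)"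

definition bergman_proj_pos :: "(complex \<Rightarrow> complex) \<Rightarrow> complex \<Rightarrow> complex" where
  "bergman_proj_pos f z =
     (LINT w:upper_half_plane|lebesgue. of_real (cmod (bergman_kernel z w)) * f w)"

text \<open>
  The log-moment is an extended nonnegative integral because its finiteness is a condition: a
  Bochner integral of a non-integrable function would silently be \<open>0\<close>.
\<close>

definition log_moment :: "(complex \<Rightarrow> complex) \<Rightarrow> ennreal" where
  "log_moment f =
     (\<integral>\<^sup>+ z\<in>upper_half_plane.
        ennreal (cmod (f z) * (ln_plus (inverse (Im z)) + ln_plus (cmod z))) \<partial>lebesgue)"

end

theory Submission
  imports Defs "HOL-Real_Asymp.Real_Asymp"
begin

text \<open>
  Integrating over horizontal lines first, \<open>|K(z,w)|\<close> has mass
  \<open>ln ((b + Im w) / (a + Im w))\<close> over the strip \<open>a \<le> Im z \<le> b\<close>, while \<open>K(z,w) - K(z,\<i>)\<close> decays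
  like \<open>|z|\<close> to the power \<open>-3\<close>. Hence the integral in \<open>z\<close> of \<open>|K(z,w) - K(z,\<i>)|\<close> is at most
  a constant times one plus the logarithmic weight of \<open>w\<close>; as \<open>f\<close> has mean zero, \<open>K(z,\<i>)\<close> may be
  subtracted from the kernel and the direct part follows by Fubini.

  For the converse, let \<open>\<phi>(E,w)\<close> be the mass of \<open>|K(\<cdot>,w)|\<close> over \<open>E\<close>. The integral of \<open>f(w) \<phi>(E,w)\<close> equals
  that of \<open>P\<^sup>+f\<close> over \<open>E\<close>, so it is bounded independently of \<open>E\<close>. For the strips \<open>1 \<le> Im z \<le> Y\<close>,
  \<open>\<phi>(E,w) / ln Y\<close> is bounded and tends to \<open>1\<close>, so \<open>f\<close> has mean zero. Then also the integral of
  \<open>f(w) (\<phi>(E,w) - \<phi>(E,\<i>))\<close> is bounded independently of \<open>E\<close>. Thin strips near the real axis make this weight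
  comparable to \<open>ln (1 / Im w)\<close>, and sectors \<open>|Re z| \<le> Im z\<close> make its negative comparable to
  \<open>ln |w|\<close>; positivity of \<open>f\<close> off \<open>K\<close> and Fatou's lemma give the logarithmic moment.
\<close>

section \<open>Integration over horizontal lines and the Poisson integral\<close>

text \<open>Agreement on open boxes characterizes \<open>lborel\<close>. The height \<open>y\<close>
  comes first in the pair, so that iterated integrals run along horizontal lines on the
  inside.\<close>

lemma lborel_complex_eq:
  "(lborel :: complex measure) = distr (lborel \<Otimes>\<^sub>M lborel) borel (\<lambda>(y, x). Complex x y)"
proof (rule lborel_eqI)
  have m: "(\<lambda>(y, x). Complex x y) \<in> borel_measurable (lborel \<Otimes>\<^sub>M lborel)"
    unfolding Complex_eq case_prod_beta by measurable
  fix l u :: complex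
  assume "\<And>b. b \<in> Basis \<Longrightarrow> l \<bullet> b \<le> u \<bullet> b"
  from this[of 1] this[of \<i>] have le: "Re l \<le> Re u" "Im l \<le> Im u"
    by (auto simp: Basis_complex_def)
  have "(\<lambda>(y, x). Complex x y) -` box l u \<inter> space (lborel \<Otimes>\<^sub>M lborel)
      = {Im l<..<Im u} \<times> {Re l<..<Re u}"
    by (auto simp: box_def Basis_complex_def space_pair_measure)
  then show "emeasure (distr (lborel \<Otimes>\<^sub>M lborel) borel (\<lambda>(y, x). Complex x y)) (box l u)
      = (\<Prod>b\<in>Basis. (u - l) \<bullet> b)"
    using le by (subst emeasure_distr[OF m])
      (auto simp: Basis_complex_def lborel.emeasure_pair_measure_Times ennreal_mult' mult_ac)
qed simp

lemma nn_integral_lborel_complex: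
  assumes "g \<in> borel_measurable (borel :: complex measure)"
  shows "(\<integral>\<^sup>+ z. g z \<partial>lborel) = (\<integral>\<^sup>+ y. \<integral>\<^sup>+ x. g (Complex x y) \<partial>lborel \<partial>lborel)"
proof -
  have m: "(\<lambda>(y, x). Complex x y) \<in> lborel \<Otimes>\<^sub>M lborel \<rightarrow>\<^sub>M borel"
    unfolding Complex_eq case_prod_beta by measurable
  have "(\<integral>\<^sup>+ z. g z \<partial>lborel) = (\<integral>\<^sup>+ p. g (case p of (y, x) \<Rightarrow> Complex x y) \<partial>(lborel \<Otimes>\<^sub>M lborel))"
    using assms m by (subst lborel_complex_eq, subst nn_integral_distr) auto
  also have "\<dots> = (\<integral>\<^sup>+ y. \<integral>\<^sup>+ x. g (Complex x y) \<partial>lborel \<partial>lborel)"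
    using measurable_compose[OF m, of g] assms
    by (subst lborel.nn_integral_fst[symmetric]) auto
  finally show ?thesis .
qed

text \<open>The integrand is \<open>pi / c\<close> times the Poisson kernel of the half-plane, which
  has total mass one. The antiderivative is an arctangent.\<close>

lemma nn_integral_Poisson:
  fixes u c :: real
  assumes "c > 0"
  shows "(\<integral>\<^sup>+ x. ennreal (1 / ((x - u)\<^sup>2 + c\<^sup>2)) \<partial>lborel) = ennreal (pi / c)"
proof -
  let ?f = "\<lambda>x. 1 / ((x - u)\<^sup>2 + c\<^sup>2)" and ?F = "\<lambda>x. arctan ((x - u) / c) / c"
  have pos: "(x - u)\<^sup>2 + c\<^sup>2 > 0" for x
    using assms by (simp add: add_nonneg_pos)
  have deriv: "DERIV ?F x :> ?f x" for x
  proof -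
    have "1 + ((x - u) / c)\<^sup>2 = ((x - u)\<^sup>2 + c\<^sup>2) / c\<^sup>2"
      using assms by (simp add: field_simps)
    then have "inverse (1 + ((x - u) / c)\<^sup>2) * (1 / c) / c = ?f x"
      using assms by (simp add: power2_eq_square)
    moreover have "DERIV ?F x :> inverse (1 + ((x - u) / c)\<^sup>2) * (1 / c) / c"
      using assms by (auto intro!: derivative_eq_intros)
    ultimately show ?thesis by metis
  qed
  have cont: "isCont ?f x" for x
    using pos[of x] by (intro continuous_intros) auto
  have "filterlim (\<lambda>x. (x - u) / c) at_top at_top" "filterlim (\<lambda>x. (x - u) / c) at_bot at_bot"
    using assms by real_asymp+
  then have "(?F \<longlongrightarrow> pi / 2 / c) at_top" "(?F \<longlongrightarrow> - (pi / 2) / c) at_bot"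
    using assms
    by (auto intro: tendsto_divide[OF filterlim_compose[OF tendsto_arctan_at_top] tendsto_const]
        tendsto_divide[OF filterlim_compose[OF tendsto_arctan_at_bot] tendsto_const]
        simp del: divide_divide_eq_left times_divide_eq_left minus_divide_left divide_minus_left)
  \<comment> \<open>The integral over the line is treated as an interval integral with infinite
    endpoints, so the limits must be stated at the extended reals.\<close>
  then have lim: "((?F \<circ> real_of_ereal) \<longlongrightarrow> pi / 2 / c) (at_left \<infinity>)"
     "((?F \<circ> real_of_ereal) \<longlongrightarrow> - (pi / 2) / c) (at_right (- \<infinity>))"
    by (simp_all add: ereal_tendsto_simps)
  note FTC = interval_integral_FTC_nonneg[OF _ deriv cont _ lim(2) lim(1)]
  have int: "integrable lborel ?f"
    using FTC(1) pos by (simp add: set_integrable_def less_imp_le)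
  have "(LBINT x. ?f x) = pi / c"
    using FTC(2) pos by (simp add: interval_lebesgue_integral_def set_lebesgue_integral_def less_imp_le)
  then show ?thesis
    using int pos by (subst nn_integral_eq_integral) (auto simp: less_imp_le)
qed

section \<open>The modulus of the kernel, its strip integrals and the kernel difference at great
  height\<close>

definition pos_kernel :: "complex \<Rightarrow> complex \<Rightarrow> real" where
  "pos_kernel z w = cmod (bergman_kernel z w)"

text \<open>By the reverse triangle inequality this also dominates the difference of the moduli, so
  one estimate serves both P and P^+.\<close>

definition kernel_diff :: "complex \<Rightarrow> complex \<Rightarrow> real" where
  "kernel_diff z w = cmod (bergman_kernel z w - bergman_kernel z \<i>)"

lemma pos_kernel_eq: "pos_kernel z w = 1 / pi * (1 / ((Re z - Re w)\<^sup>2 + (Im z + Im w)\<^sup>2))"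
proof -
  have "(cmod (z - cnj w))\<^sup>2 = (Re z - Re w)\<^sup>2 + (Im z + Im w)\<^sup>2"
    by (simp add: cmod_power2)
  then show ?thesis
    by (simp add: pos_kernel_def bergman_kernel_def norm_divide norm_mult norm_power)
qed

lemma pos_kernel_nonneg [simp]: "pos_kernel z w \<ge> 0"
  by (simp add: pos_kernel_def)

lemma kernel_diff_nonneg [simp]: "kernel_diff z w \<ge> 0"
  by (simp add: kernel_diff_def)

lemma measurable_bergman_kernel [measurable]:
  "case_prod bergman_kernel \<in> borel_measurable (borel \<Otimes>\<^sub>M borel)"
proof -
  have [measurable]: "cnj \<in> borel_measurable borel"
    by (intro borel_measurable_continuous_onI continuous_intros)
  show ?thesis
    unfolding bergman_kernel_def case_prod_beta by measurable
qed

lemma measurable_bergman_kernel' [measurable (raw)]: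
  assumes "f \<in> borel_measurable M" "g \<in> borel_measurable M"
  shows "(\<lambda>x. bergman_kernel (f x) (g x)) \<in> borel_measurable M"
  using measurable_compose[OF measurable_Pair[OF assms] measurable_bergman_kernel] by simp

lemma measurable_pos_kernel [measurable (raw)]:
  assumes [measurable]: "f \<in> borel_measurable M" "g \<in> borel_measurable M"
  shows "(\<lambda>x. pos_kernel (f x) (g x)) \<in> borel_measurable M"
  unfolding pos_kernel_def by measurable

lemma measurable_kernel_diff [measurable (raw)]:
  assumes [measurable]: "f \<in> borel_measurable M" "g \<in> borel_measurable M"
  shows "(\<lambda>x. kernel_diff (f x) (g x)) \<in> borel_measurable M"
  unfolding kernel_diff_def by measurable

lemma measurable_Re_Im [measurable (raw)]:
  assumes "f \<in> borel_measurable M"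
  shows "(\<lambda>x. Re (f x)) \<in> borel_measurable M" "(\<lambda>x. Im (f x)) \<in> borel_measurable M"
  using assms by (auto intro: borel_measurable_Re borel_measurable_Im measurable_compose)

lemma sets_upper_half_plane [measurable]: "upper_half_plane \<in> sets borel"
  unfolding upper_half_plane_def by measurable

text \<open>By the Poisson integral the horizontal line at height \<open>y\<close> contributes
  \<open>1 / (y + Im w)\<close>. The vanishing of \<open>h\<close> below the real axis keeps
  \<open>y + Im w\<close> positive wherever that formula is applied.\<close>

lemma nn_integral_pos_kernel_weight:
  fixes h :: "real \<Rightarrow> ennreal"
  assumes [measurable]: "h \<in> borel_measurable borel"
    and h0: "\<And>y. y < 0 \<Longrightarrow> h y = 0" and w: "Im w > 0"
  shows "(\<integral>\<^sup>+ z. h (Im z) * ennreal (pos_kernel z w) \<partial>lborel)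
    = (\<integral>\<^sup>+ y. h y * ennreal (1 / (y + Im w)) \<partial>lborel)"
proof -
  have "(\<integral>\<^sup>+ x. h y * ennreal (pos_kernel (Complex x y) w) \<partial>lborel) = h y * ennreal (1 / (y + Im w))" for y
  proof (cases "y < 0")
    case False
    have "(\<integral>\<^sup>+ x. h y * ennreal (pos_kernel (Complex x y) w) \<partial>lborel)
      = h y * (\<integral>\<^sup>+ x. ennreal (pos_kernel (Complex x y) w) \<partial>lborel)"
      by (rule nn_integral_cmult) (simp add: pos_kernel_eq)
    also have "(\<integral>\<^sup>+ x. ennreal (pos_kernel (Complex x y) w) \<partial>lborel)
       = ennreal (1 / pi) * (\<integral>\<^sup>+ x. ennreal (1 / ((x - Re w)\<^sup>2 + (y + Im w)\<^sup>2)) \<partial>lborel)"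
      by (subst nn_integral_cmult[symmetric]) (auto simp: pos_kernel_eq ennreal_mult[symmetric])
    also have "\<dots> = ennreal (1 / (y + Im w))"
      using False w by (subst nn_integral_Poisson) (auto simp: ennreal_mult[symmetric])
    finally show ?thesis .
  qed (simp add: h0)
  then show ?thesis
    by (subst nn_integral_lborel_complex) auto
qed

lemma nn_integral_pos_kernel_strip:
  assumes "0 \<le> a" "a \<le> b" "Im w > 0"
  shows "(\<integral>\<^sup>+ z. indicator {z. Im z \<in> {a..b}} z * ennreal (pos_kernel z w) \<partial>lborel)
    = ennreal (ln ((b + Im w) / (a + Im w)))"
proof -
  have "(\<integral>\<^sup>+ z. indicator {z. Im z \<in> {a..b}} z * ennreal (pos_kernel z w) \<partial>lborel)
    = (\<integral>\<^sup>+ z. indicator {a..b} (Im z) * ennreal (pos_kernel z w) \<partial>lborel)"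
    by (intro nn_integral_cong) (auto simp: indicator_def)
  also have "\<dots> = (\<integral>\<^sup>+ y. indicator {a..b} y * ennreal (1 / (y + Im w)) \<partial>lborel)"
    using assms by (intro nn_integral_pos_kernel_weight) auto
  also have "\<dots> = (\<integral>\<^sup>+ y. ennreal (1 / (y + Im w)) * indicator {a..b} y \<partial>lborel)"
    by (simp add: mult.commute)
  also have "\<dots> = ennreal (ln (b + Im w) - ln (a + Im w))"
    using assms
    by (intro nn_integral_FTC_Icc) (auto intro!: derivative_eq_intros simp: divide_simps)
  finally show ?thesis
    using assms by (simp add: ln_div)
qed

text \<open>Above height \<open>R\<close> the distances from \<open>z\<close> to \<open>cnj w\<close> and to \<open>-\<i>\<close> are comparable.\<close>

lemma kernel_diff_upper:
  assumes R: "R \<ge> 1" "cmod w \<le> R" and w: "Im w > 0" and z: "Im z \<ge> R"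
  shows "kernel_diff z w \<le> 24 * R / (Im z + 1) * pos_kernel z \<i>"
proof -
  \<comment> \<open>The squares of these two numbers are the denominators of the two kernels, since
    \<open>cnj \<i> = - \<i>\<close>.\<close>
  define a b where "a = z - cnj w" and "b = z + \<i>"
  have a: "cmod a \<ge> R"
    using abs_Im_le_cmod[of a] w z R by (simp add: a_def)
  have b: "cmod b \<ge> R" "cmod b \<ge> Im z + 1"
    using abs_Im_le_cmod[of b] w z R by (simp_all add: b_def)
  have ba: "cmod (b - a) \<le> 2 * R"
    using norm_triangle_ineq[of "\<i>" "cnj w"] R by (simp add: a_def b_def)
  have b3: "cmod b \<le> 3 * cmod a"
    using norm_triangle_ineq[of a "b - a"] ba a by simp
  have nz: "a \<noteq> 0" "b \<noteq> 0"
    using a b R by auto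
  have "kernel_diff z w = cmod (1 / pi * (1 / b\<^sup>2 - 1 / a\<^sup>2))"
    by (simp add: kernel_diff_def bergman_kernel_def a_def b_def algebra_simps)
  \<comment> \<open>Factoring the difference of squares isolates \<open>b - a\<close>, whose modulus
    is at most \<open>2 * R\<close> however large \<open>z\<close> is. This is the gain of one power
    of the distance.\<close>
  also have "1 / b\<^sup>2 - 1 / a\<^sup>2 = - ((b - a) * (b + a) / (a\<^sup>2 * b\<^sup>2))"
    using nz by (simp add: field_simps power2_eq_square)
  also have "cmod (1 / pi * (- ((b - a) * (b + a) / (a\<^sup>2 * b\<^sup>2))))
      = 1 / pi * (cmod (b - a) * cmod (b + a) / ((cmod a)\<^sup>2 * (cmod b)\<^sup>2))"
    by (simp add: norm_mult norm_divide norm_power)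
  also have "\<dots> \<le> 1 / pi * (2 * R * (4 * cmod a) / ((cmod a)\<^sup>2 * (cmod b)\<^sup>2))"
    using norm_triangle_ineq[of b a] ba b3 R
    by (intro mult_left_mono divide_right_mono mult_mono) auto
  also have "\<dots> = 8 * R / cmod a * (1 / pi * (1 / (cmod b)\<^sup>2))"
    using nz by (simp add: field_simps power2_eq_square)
  \<comment> \<open>The chain \<open>Im z + 1 \<le> cmod b \<le> 3 * cmod a\<close> trades
    \<open>1 / cmod a\<close> for a function of the height alone, turning 8 into 24.\<close>
  also have "\<dots> \<le> 24 * R / (Im z + 1) * (1 / pi * (1 / (cmod b)\<^sup>2))"
  proof (intro mult_right_mono)
    have "Im z + 1 \<le> 3 * cmod a"
      using b b3 by linarith
    then have "8 * R * (Im z + 1) \<le> 8 * R * (3 * cmod a)"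
      using R by (intro mult_left_mono) auto
    then show "8 * R / cmod a \<le> 24 * R / (Im z + 1)"
      using z R nz by (simp add: field_simps)
  qed simp
  also have "1 / pi * (1 / (cmod b)\<^sup>2) = pos_kernel z \<i>"
    by (simp add: pos_kernel_eq b_def cmod_power2)
  finally show ?thesis .
qed

text \<open>The additional factor \<open>R / (Im z + 1)\<close> makes the integral over heights
  converge: the integral of \<open>24 * R / (y + 1)\<^sup>2\<close> from \<open>R\<close> on is
  \<open>24 * R / (R + 1)\<close>, and the dependence on \<open>w\<close> disappears.\<close>

lemma nn_integral_kernel_diff_upper:
  assumes R: "R \<ge> 1" "cmod w \<le> R" and w: "Im w > 0"
  shows "(\<integral>\<^sup>+ z. indicator {z. Im z \<in> {R..}} z * ennreal (kernel_diff z w) \<partial>lborel) \<le> 24"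
proof -
  let ?h = "\<lambda>y. ennreal (24 * R / (y + 1)) * indicator {R..} y"
  have "(\<integral>\<^sup>+ z. indicator {z. Im z \<in> {R..}} z * ennreal (kernel_diff z w) \<partial>lborel)
      \<le> (\<integral>\<^sup>+ z. ?h (Im z) * ennreal (pos_kernel z \<i>) \<partial>lborel)"
    using kernel_diff_upper[OF assms] R
    by (intro nn_integral_mono) (auto simp: indicator_def ennreal_mult[symmetric] intro!: ennreal_leI)
  also have "\<dots> = (\<integral>\<^sup>+ y. ?h y * ennreal (1 / (y + Im \<i>)) \<partial>lborel)"
    using R by (intro nn_integral_pos_kernel_weight) auto
  also have "\<dots> = (\<integral>\<^sup>+ y. ennreal (24 * R / (y + 1)\<^sup>2) * indicator {R..} y \<partial>lborel)"
    using R by (intro nn_integral_cong)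
      (auto simp: indicator_def ennreal_mult[symmetric] power2_eq_square)
  also have "\<dots> = ennreal (0 - (- 24 * R / (R + 1)))"
  proof (rule nn_integral_FTC_atLeast[where F = "\<lambda>y. - 24 * R / (y + 1)"])
    show "((\<lambda>y. - 24 * R / (y + 1)) \<longlongrightarrow> 0) at_top"
      by real_asymp
  qed (use R in \<open>auto intro!: derivative_eq_intros simp: power2_eq_square field_simps\<close>)
  also have "\<dots> \<le> ennreal 24"
    using R by (intro ennreal_leI) (simp add: field_simps)
  finally show ?thesis by simp
qed

section \<open>The kernel difference integrated over the half-plane\<close>

definition log_weight :: "complex \<Rightarrow> real" where
  "log_weight w = ln_plus (inverse (Im w)) + ln_plus (cmod w)"

lemma ln_plus_nonneg [simp]: "ln_plus t \<ge> 0"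
  by (simp add: ln_plus_def)

lemma ln_le_ln_plus: "t > 0 \<Longrightarrow> ln t \<le> ln_plus t"
  by (simp add: ln_plus_def)

lemma ln_max_1: "ln (max 1 t) = ln_plus t"
  by (auto simp: ln_plus_def max_def not_le)

lemma log_weight_nonneg [simp]: "log_weight w \<ge> 0"
  by (simp add: log_weight_def)

text \<open>The half-plane is cut at height \<open>R = max 1 (cmod w)\<close>. Above the cut the
  cancellation between the kernels bounds the integral by 24. Below it the triangle inequality is
  enough, as the two strip masses are only logarithmic.\<close>

lemma nn_integral_kernel_diff:
  assumes w: "Im w > 0"
  shows "(\<integral>\<^sup>+ z. indicator upper_half_plane z * ennreal (kernel_diff z w) \<partial>lborel)
    \<le> ennreal (26 * (1 + log_weight w))"
proof -
  define R where "R = max 1 (cmod w)"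
  let ?S = "{z. Im z \<in> {0..R}}" and ?U = "{z. Im z \<in> {R..}}"
  have R: "R \<ge> 1" "cmod w \<le> R" by (auto simp: R_def)
  have v: "Im w \<le> R"
    using abs_Im_le_cmod[of w] R by linarith
  have lnR: "ln R = ln_plus (cmod w)"
    by (simp add: R_def ln_max_1)
  have ln2: "ln 2 \<le> (1::real)"
    using ln_2_less_1 by simp
  \<comment> \<open>Since \<open>Im w \<le> R\<close>, the numerator is at most
    \<open>2 * R\<close>; the factor 2 produces the summand 1 next to
    \<open>log_weight w\<close>.\<close>
  have "ln ((R + Im w) / (0 + Im w)) \<le> ln (2 * R * inverse (Im w))"
    using w v R by (subst ln_le_cancel_iff) (auto simp: field_simps)
  also have "\<dots> = ln 2 + ln R + ln (inverse (Im w))"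
    using w R by (simp add: ln_mult ln_inverse)
  finally have s1: "ln ((R + Im w) / (0 + Im w)) \<le> 1 + log_weight w"
    using ln_le_ln_plus[of "inverse (Im w)"] w ln2 by (simp add: log_weight_def lnR)
  have "ln ((R + Im \<i>) / (0 + Im \<i>)) \<le> ln (2 * R)"
    using R by (subst ln_le_cancel_iff) auto
  also have "ln (2 * R) = ln 2 + ln_plus (cmod w)"
    using R by (simp add: ln_mult lnR)
  also have "\<dots> \<le> 1 + log_weight w"
    unfolding log_weight_def using ln2 ln_plus_nonneg[of "inverse (Im w)"] by linarith
  finally have s2: "ln ((R + Im \<i>) / (0 + Im \<i>)) \<le> 1 + log_weight w" .
  have le: "indicator upper_half_plane z * ennreal (kernel_diff z w)
       \<le> (indicator ?S z * ennreal (pos_kernel z w) + indicator ?S z * ennreal (pos_kernel z \<i>))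
          + indicator ?U z * ennreal (kernel_diff z w)" for z
    using norm_triangle_ineq4[of "bergman_kernel z w" "bergman_kernel z \<i>"]
    by (auto simp: indicator_def upper_half_plane_def kernel_diff_def pos_kernel_def
        ennreal_plus[symmetric] simp del: ennreal_plus intro!: ennreal_leI)
  have "(\<integral>\<^sup>+ z. indicator upper_half_plane z * ennreal (kernel_diff z w) \<partial>lborel)
     \<le> (\<integral>\<^sup>+ z. (indicator ?S z * ennreal (pos_kernel z w) + indicator ?S z * ennreal (pos_kernel z \<i>))
          + indicator ?U z * ennreal (kernel_diff z w) \<partial>lborel)"
    by (rule nn_integral_mono) (rule le)
  also have "\<dots> = (\<integral>\<^sup>+ z. indicator ?S z * ennreal (pos_kernel z w) \<partial>lborel)
      + (\<integral>\<^sup>+ z. indicator ?S z * ennreal (pos_kernel z \<i>) \<partial>lborel)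
      + (\<integral>\<^sup>+ z. indicator ?U z * ennreal (kernel_diff z w) \<partial>lborel)"
    by (simp add: nn_integral_add)
  also have "\<dots> \<le> ennreal (1 + log_weight w) + ennreal (1 + log_weight w) + 24"
  proof (intro add_mono)
    show "(\<integral>\<^sup>+ z. indicator ?S z * ennreal (pos_kernel z w) \<partial>lborel) \<le> ennreal (1 + log_weight w)"
      using w R s1 by (subst nn_integral_pos_kernel_strip) (simp_all add: ennreal_leI del: ennreal_plus)
    show "(\<integral>\<^sup>+ z. indicator ?S z * ennreal (pos_kernel z \<i>) \<partial>lborel) \<le> ennreal (1 + log_weight w)"
      using R s2 by (subst nn_integral_pos_kernel_strip) (simp_all add: ennreal_leI del: ennreal_plus)
  qed (rule nn_integral_kernel_diff_upper[OF R w])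
  also have "\<dots> = ennreal (1 + log_weight w + (1 + log_weight w) + 24)"
  proof -
    have "ennreal x + ennreal x + 24 = ennreal (x + x + 24)" if "x \<ge> 0" for x
      using that by (simp flip: ennreal_plus ennreal_numeral)
    then show ?thesis by (simp del: ennreal_plus)
  qed
  \<comment> \<open>Here 26 is 2 for the two strips plus 24 for the upper region.\<close>
  also have "\<dots> \<le> ennreal (26 * (1 + log_weight w))"
    by (intro ennreal_leI) simp
  finally show ?thesis .
qed

section \<open>Kernel masses of sets in strips away from the real axis\<close>

text \<open>A real-valued integral, so that masses can be subtracted. It is the true mass when
  \<open>E\<close> is a Borel set in a strip at positive height and \<open>Im w > 0\<close>, by
  \<open>ennreal_kernel_mass\<close>.\<close>

definition kernel_mass :: "complex set \<Rightarrow> complex \<Rightarrow> real" where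
  "kernel_mass E w = (\<integral> z. indicator E z * pos_kernel z w \<partial>lborel)"

abbreviation strip :: "real \<Rightarrow> real \<Rightarrow> complex set" where
  "strip a b \<equiv> {z. Im z \<in> {a..b}}"

lemma sets_strip [measurable]: "strip a b \<in> sets borel"
  by measurable

text \<open>The mass of the whole strip is \<open>ln ((b + v) / (a + v))\<close> with
  \<open>v = Im w\<close>, which decreases in \<open>v\<close>. The resulting bound
  \<open>ln (b / a)\<close> is uniform in \<open>w\<close>, as Fubini and dominated convergence will
  require.\<close>

lemma
  assumes E [measurable]: "E \<in> sets borel" and sub: "E \<subseteq> strip a b"
    and ab: "0 < a" "a \<le> b" and w: "Im w > 0"
  shows integrable_kernel_mass: "integrable lborel (\<lambda>z. indicator E z * pos_kernel z w)"
    and kernel_mass_le: "kernel_mass E w \<le> ln (b / a)"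
    and ennreal_kernel_mass:
      "ennreal (kernel_mass E w) = (\<integral>\<^sup>+ z. indicator E z * ennreal (pos_kernel z w) \<partial>lborel)"
proof -
  have eq: "(\<integral>\<^sup>+ z. indicator E z * ennreal (pos_kernel z w) \<partial>lborel)
      = (\<integral>\<^sup>+ z. ennreal (indicator E z * pos_kernel z w) \<partial>lborel)"
    by (intro nn_integral_cong) (simp add: indicator_def)
  have le: "(\<integral>\<^sup>+ z. indicator E z * ennreal (pos_kernel z w) \<partial>lborel) \<le> ennreal (ln (b / a))"
  proof -
    have "(\<integral>\<^sup>+ z. indicator E z * ennreal (pos_kernel z w) \<partial>lborel)
       \<le> (\<integral>\<^sup>+ z. indicator (strip a b) z * ennreal (pos_kernel z w) \<partial>lborel)"
      using sub by (intro nn_integral_mono mult_right_mono) (auto simp: indicator_def)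
    also have "\<dots> = ennreal (ln ((b + Im w) / (a + Im w)))"
      using ab w by (intro nn_integral_pos_kernel_strip) auto
    also have "\<dots> \<le> ennreal (ln (b / a))"
    proof (intro ennreal_leI)
      have "a * Im w \<le> b * Im w" using ab w by (intro mult_right_mono) auto
      then have "(b + Im w) / (a + Im w) \<le> b / a"
        using ab w by (simp add: field_simps)
      then show "ln ((b + Im w) / (a + Im w)) \<le> ln (b / a)"
        using ab w by (subst ln_le_cancel_iff) auto
    qed
    finally show ?thesis .
  qed
  show int: "integrable lborel (\<lambda>z. indicator E z * pos_kernel z w)"
    using le_less_trans[OF le] eq
    by (intro integrableI_bounded) (auto simp: abs_mult indicator_def)
  show *: "ennreal (kernel_mass E w) = (\<integral>\<^sup>+ z. indicator E z * ennreal (pos_kernel z w) \<partial>lborel)"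
    unfolding kernel_mass_def eq by (rule nn_integral_eq_integral[symmetric, OF int]) simp
  show "kernel_mass E w \<le> ln (b / a)"
    using le ab unfolding *[symmetric] by (subst (asm) ennreal_le_iff) auto
qed

lemma kernel_mass_nonneg [simp]: "kernel_mass E w \<ge> 0"
  unfolding kernel_mass_def by (intro Bochner_Integration.integral_nonneg) simp

lemma measurable_kernel_mass [measurable (raw)]:
  assumes [measurable]: "E \<in> sets borel" "f \<in> borel_measurable M"
  shows "(\<lambda>x. kernel_mass E (f x)) \<in> borel_measurable M"
proof -
  have "kernel_mass E \<in> borel_measurable borel"
    unfolding kernel_mass_def by measurable
  then show ?thesis
    using assms(2) by simp
qed

lemma kernel_mass_strip:
  assumes "0 < a" "a \<le> b" "Im w > 0"
  shows "kernel_mass (strip a b) w = ln ((b + Im w) / (a + Im w))"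
proof -
  have "ennreal (kernel_mass (strip a b) w) = ennreal (ln ((b + Im w) / (a + Im w)))"
    using assms nn_integral_pos_kernel_strip[of a b w]
    by (subst ennreal_kernel_mass[where a = a and b = b]) auto
  then show ?thesis
    using assms by (subst (asm) ennreal_inj) auto
qed

text \<open>The bound \<open>c\<close> comes from the region \<open>F\<close> only and is therefore
  the same for all \<open>E\<close> inside it. Below, \<open>F\<close> is either the whole
  half-plane or its part above some height.\<close>

lemma kernel_mass_diff:
  assumes [measurable]: "E \<in> sets borel" and sub: "E \<subseteq> strip a b" "E \<subseteq> F"
    and ab: "0 < a" "a \<le> b" and w: "Im w > 0"
    and le: "(\<integral>\<^sup>+ z. indicator F z * ennreal (kernel_diff z w) \<partial>lborel) \<le> ennreal c" and c: "c \<ge> 0"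
  shows "\<bar>kernel_mass E w - kernel_mass E \<i>\<bar> \<le> c"
proof -
  note int = integrable_kernel_mass[OF assms(1) sub(1) ab]
  have "kernel_mass E w - kernel_mass E \<i>
    = (\<integral> z. indicator E z * pos_kernel z w - indicator E z * pos_kernel z \<i> \<partial>lborel)"
    unfolding kernel_mass_def by (rule Bochner_Integration.integral_diff[symmetric]) (use int w in auto)
  also have "ennreal (norm \<dots>)
    \<le> (\<integral>\<^sup>+ z. ennreal (norm (indicator E z * pos_kernel z w - indicator E z * pos_kernel z \<i>)) \<partial>lborel)"
    by (rule integral_norm_bound_ennreal) (use int w in auto)
  also have "\<dots> \<le> (\<integral>\<^sup>+ z. indicator F z * ennreal (kernel_diff z w) \<partial>lborel)"
    using sub norm_triangle_ineq3
    by (intro nn_integral_mono) (auto simp: indicator_def pos_kernel_def kernel_diff_def intro!: ennreal_leI)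
  finally have "ennreal (norm (kernel_mass E w - kernel_mass E \<i>)) \<le> ennreal c"
    using le by (rule order_trans)
  then show ?thesis
    using c by (simp add: ennreal_le_iff)
qed

lemma kernel_mass_diff_log_weight:
  assumes "E \<in> sets borel" "E \<subseteq> strip a b" "0 < a" "a \<le> b" "Im w > 0"
  shows "\<bar>kernel_mass E w - kernel_mass E \<i>\<bar> \<le> 26 * (1 + log_weight w)"
proof -
  have "E \<subseteq> upper_half_plane"
    using assms by (force simp: upper_half_plane_def)
  with assms show ?thesis
    by (intro kernel_mass_diff[where F = upper_half_plane and a = a and b = b] nn_integral_kernel_diff)
      simp_all
qed

section \<open>Kernel masses of truncated sectors\<close>

text \<open>The mass of a strip depends on \<open>w\<close> only through \<open>Im w\<close> and
  cannot detect a large real part. A sector stays far from \<open>cnj w\<close> up to heights of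
  order \<open>cmod w\<close>, whatever the direction of \<open>w\<close>.\<close>

definition sector :: "real \<Rightarrow> complex set" where
  "sector Y = {z. 1 \<le> Im z \<and> Im z \<le> Y \<and> \<bar>Re z\<bar> \<le> Im z}"

lemma sets_sector [measurable]: "sector Y \<in> sets borel"
  unfolding sector_def by measurable

lemma sector_subset_strip: "sector Y \<subseteq> strip 1 Y"
  by (auto simp: sector_def)

text \<open>At height \<open>y\<close> the sector has width \<open>2 * y\<close>, and there
  \<open>x\<^sup>2 + (y + 1)\<^sup>2 \<le> 5 * y\<^sup>2\<close>. So each height contributes at
  least \<open>2 / (5 * pi * y)\<close>, which integrates to a logarithm.\<close>

lemma kernel_mass_sector_lower:
  assumes m: "m \<ge> 1"
  shows "2 / (5 * pi) * ln m \<le> kernel_mass (sector m) \<i>"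
proof -
  have "ennreal (2 / (5 * pi) * ln m) = ennreal (2 / (5 * pi) * ln m - 2 / (5 * pi) * ln 1)"
    by simp
  also have "\<dots> = (\<integral>\<^sup>+ y. ennreal (2 / (5 * pi) / y) * indicator {1..m} y \<partial>lborel)"
    using m by (intro nn_integral_FTC_Icc[symmetric]) (auto intro!: derivative_eq_intros)
  also have "\<dots> \<le> (\<integral>\<^sup>+ y. \<integral>\<^sup>+ x. indicator (sector m) (Complex x y)
      * ennreal (pos_kernel (Complex x y) \<i>) \<partial>lborel \<partial>lborel)"
  proof (intro nn_integral_mono)
    fix y :: real
    show "ennreal (2 / (5 * pi) / y) * indicator {1..m} y
      \<le> (\<integral>\<^sup>+ x. indicator (sector m) (Complex x y) * ennreal (pos_kernel (Complex x y) \<i>) \<partial>lborel)"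
    proof (cases "y \<in> {1..m}")
      case True
      then have y: "1 \<le> y" "y \<le> m" by auto
      have "ennreal (2 / (5 * pi) / y) * indicator {1..m} y = ennreal (1 / (5 * pi * y\<^sup>2)) * ennreal (2 * y)"
        using y by (simp add: ennreal_mult[symmetric] power2_eq_square)
      also have "ennreal (2 * y) = emeasure lborel {- y..y}"
        using y by simp
      also have "ennreal (1 / (5 * pi * y\<^sup>2)) * emeasure lborel {- y..y}
          = (\<integral>\<^sup>+ x. ennreal (1 / (5 * pi * y\<^sup>2)) * indicator {- y..y} x \<partial>lborel)"
        by (rule nn_integral_cmult_indicator[symmetric]) simp
      also have "\<dots> \<le> (\<integral>\<^sup>+ x. indicator (sector m) (Complex x y) * ennreal (pos_kernel (Complex x y) \<i>) \<partial>lborel)"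
      proof (intro nn_integral_mono)
        fix x :: real
        have "1 / (5 * pi * y\<^sup>2) \<le> pos_kernel (Complex x y) \<i>" if "x \<in> {- y..y}"
        proof -
          have "x\<^sup>2 \<le> y\<^sup>2"
            using that y by (subst abs_le_square_iff[symmetric]) auto
          moreover have "(y + 1)\<^sup>2 \<le> (2 * y)\<^sup>2"
            using y by (intro power_mono) auto
          ultimately have le: "x\<^sup>2 + (y + 1)\<^sup>2 \<le> 5 * y\<^sup>2"
            by (simp add: power_mult_distrib)
          have "0 < x\<^sup>2 + (y + 1)\<^sup>2"
            using y by (intro add_nonneg_pos) auto
          then have "1 / (5 * y\<^sup>2) \<le> 1 / (x\<^sup>2 + (y + 1)\<^sup>2)"
            using le y by (intro divide_left_mono mult_pos_pos) auto
          then have "1 / pi * (1 / (5 * y\<^sup>2)) \<le> 1 / pi * (1 / (x\<^sup>2 + (y + 1)\<^sup>2))"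
            by (intro mult_left_mono) auto
          then show ?thesis by (simp add: pos_kernel_eq mult_ac)
        qed
        then show "ennreal (1 / (5 * pi * y\<^sup>2)) * indicator {- y..y} x
          \<le> indicator (sector m) (Complex x y) * ennreal (pos_kernel (Complex x y) \<i>)"
          using y by (auto simp: indicator_def sector_def intro!: ennreal_leI)
      qed
      finally show ?thesis .
    qed simp
  qed
  also have "\<dots> = (\<integral>\<^sup>+ z. indicator (sector m) z * ennreal (pos_kernel z \<i>) \<partial>lborel)"
    by (rule nn_integral_lborel_complex[symmetric]) measurable
  also have "\<dots> = ennreal (kernel_mass (sector m) \<i>)"
    using m sector_subset_strip by (subst ennreal_kernel_mass[where a = 1 and b = m]) auto
  finally show ?thesis
    by (subst (asm) ennreal_le_iff) auto
qed

text \<open>With \<open>T = max 1 (cmod w)\<close>, points of the sector are at distance at least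
  \<open>T / 3\<close> from \<open>cnj w\<close>: \<open>cmod z \<le> 2 * Im z\<close>, and
  \<open>Im z\<close> is itself at most that distance. The sector fits in a box of area
  \<open>2 * T\<^sup>2\<close>, so the mass is at most \<open>18 / pi\<close>.\<close>

lemma kernel_mass_sector_upper:
  assumes m: "1 \<le> m" "m \<le> max 1 (cmod w)" and w: "Im w > 0"
  shows "kernel_mass (sector m) w \<le> 6"
proof -
  define T where "T = max 1 (cmod w)"
  have T: "T \<ge> 1" "T \<ge> cmod w" by (auto simp: T_def)
  let ?B = "cbox (Complex (- T) 0) (Complex T T)"
  have le: "pos_kernel z w \<le> 9 / (pi * T\<^sup>2)" "z \<in> ?B" if "z \<in> sector m" for z
  proof -
    from that have z: "1 \<le> Im z" "Im z \<le> m" "\<bar>Re z\<bar> \<le> Im z" by (auto simp: sector_def)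
    show "z \<in> ?B"
      using z m by (auto simp: in_cbox_complex_iff T_def)
    define a where "a = z - cnj w"
    have a: "Im z \<le> cmod a"
      using abs_Im_le_cmod[of a] w z by (simp add: a_def)
    have "cmod w \<le> cmod z + cmod a"
      using norm_triangle_ineq4[of z a] by (simp add: a_def)
    moreover have "cmod z \<le> 2 * Im z"
      using cmod_le[of z] z by simp
    ultimately have "T \<le> 3 * cmod a"
      using a z by (simp add: T_def)
    then have "T\<^sup>2 \<le> (3 * cmod a)\<^sup>2"
      using T by (intro power_mono) auto
    then have "T\<^sup>2 \<le> 9 * (cmod a)\<^sup>2" by (simp add: power_mult_distrib)
    then have "9 / (pi * (9 * (cmod a)\<^sup>2)) \<le> 9 / (pi * T\<^sup>2)"
      using T a z by (intro divide_left_mono mult_left_mono mult_pos_pos) auto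
    then have "1 / (pi * (cmod a)\<^sup>2) \<le> 9 / (pi * T\<^sup>2)"
      by simp
    then show "pos_kernel z w \<le> 9 / (pi * T\<^sup>2)"
      by (simp add: pos_kernel_eq a_def cmod_power2)
  qed
  have "ennreal (kernel_mass (sector m) w) = (\<integral>\<^sup>+ z. indicator (sector m) z * ennreal (pos_kernel z w) \<partial>lborel)"
    using m w sector_subset_strip by (intro ennreal_kernel_mass[where a = 1 and b = m]) auto
  also have "\<dots> \<le> (\<integral>\<^sup>+ z. ennreal (9 / (pi * T\<^sup>2)) * indicator ?B z \<partial>lborel)"
    using le by (intro nn_integral_mono) (auto simp: indicator_def intro!: ennreal_leI)
  also have "\<dots> = ennreal (9 / (pi * T\<^sup>2)) * emeasure lborel ?B"
    by (rule nn_integral_cmult_indicator) simp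
  also have "emeasure lborel ?B = ennreal (2 * T * T)"
    using T by (subst emeasure_lborel_cbox) (auto simp: Basis_complex_def)
  also have "ennreal (9 / (pi * T\<^sup>2)) * ennreal (2 * T * T) = ennreal (18 / pi)"
    using T by (simp add: ennreal_mult[symmetric] power2_eq_square)
  also have "\<dots> \<le> ennreal 6"
    using pi_gt3 by (intro ennreal_leI) (simp add: field_simps)
  finally show ?thesis by (subst (asm) ennreal_le_iff) auto
qed

text \<open>The sector is cut at \<open>m = min Y T\<close>. Below \<open>m\<close> the mass at
  \<open>\<i>\<close> is logarithmic while that at \<open>w\<close> is at most 6. Above
  \<open>m\<close> the two masses differ by at most 24, hence the 30.\<close>

lemma kernel_mass_sector_diff:
  assumes Y: "1 \<le> Y" and w: "Im w > 0"
  shows "2 / (5 * pi) * ln (min Y (max 1 (cmod w))) - 30 \<le> kernel_mass (sector Y) \<i> - kernel_mass (sector Y) w"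
proof -
  define T where "T = max 1 (cmod w)"
  define m where "m = min Y T"
  have T: "T \<ge> 1" "T \<ge> cmod w" by (auto simp: T_def)
  have m: "1 \<le> m" "m \<le> T" "m \<le> Y" using Y T by (auto simp: m_def)
  let ?U = "sector Y - sector m"
  \<comment> \<open>If \<open>Y \<le> T\<close>, then \<open>m = Y\<close> and this set is empty, so
    the second inclusion holds in both cases.\<close>
  have U: "?U \<subseteq> strip 1 Y" "?U \<subseteq> {z. Im z \<in> {T..}}"
    by (auto simp: sector_def m_def)
  have split: "kernel_mass (sector Y) v = kernel_mass (sector m) v + kernel_mass ?U v" if v: "Im v > 0" for v
  proof -
    have "indicator (sector Y) z * pos_kernel z v
      = indicator (sector m) z * pos_kernel z v + indicator ?U z * pos_kernel z v" for z
      using m by (auto simp: indicator_def sector_def)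
    then show ?thesis
      unfolding kernel_mass_def using v Y m U sector_subset_strip
      by (simp, intro Bochner_Integration.integral_add)
        (auto intro!: integrable_kernel_mass[where a = 1 and b = Y] simp: sector_def)
  qed
  have split_i: "kernel_mass (sector Y) \<i> = kernel_mass (sector m) \<i> + kernel_mass ?U \<i>"
    by (rule split) simp
  have "\<bar>kernel_mass ?U w - kernel_mass ?U \<i>\<bar> \<le> 24"
    using nn_integral_kernel_diff_upper[OF T w] Y w U
    by (intro kernel_mass_diff[where a = 1 and b = Y]) auto
  moreover have "2 / (5 * pi) * ln m \<le> kernel_mass (sector m) \<i>"
    using m by (intro kernel_mass_sector_lower)
  moreover have "kernel_mass (sector m) w \<le> 6"
    using m w by (intro kernel_mass_sector_upper) (auto simp: T_def)
  ultimately show ?thesis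
    using split[OF w] split_i unfolding m_def T_def by linarith
qed

section \<open>Integral operators on half-plane functions and the direct part\<close>

text \<open>The kernel is a parameter so that P and P^+ are treated together. Integration is over
  the whole plane because the functions inserted vanish off the half-plane.\<close>

definition kernel_proj ::
    "(complex \<Rightarrow> complex \<Rightarrow> complex) \<Rightarrow> (complex \<Rightarrow> complex) \<Rightarrow> complex \<Rightarrow> complex" where
  "kernel_proj \<kappa> g z = (\<integral> w. \<kappa> z w * g w \<partial>lborel)"

lemma pos_kernel_le:
  assumes "Im z > 0" "Im w > 0"
  shows "pos_kernel z w \<le> 1 / (pi * (Im z)\<^sup>2)"
proof -
  have "(Im z)\<^sup>2 \<le> (Im z + Im w)\<^sup>2"
    using assms by (intro power_mono) auto
  then have "(Im z)\<^sup>2 \<le> (Re z - Re w)\<^sup>2 + (Im z + Im w)\<^sup>2"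
    by (rule add_increasing[OF zero_le_power2])
  moreover have "0 < (Im z)\<^sup>2"
    using assms by simp
  ultimately have "1 / ((Re z - Re w)\<^sup>2 + (Im z + Im w)\<^sup>2) \<le> 1 / (Im z)\<^sup>2"
    by (intro divide_left_mono mult_pos_pos) linarith+
  then have "1 / pi * (1 / ((Re z - Re w)\<^sup>2 + (Im z + Im w)\<^sup>2)) \<le> 1 / pi * (1 / (Im z)\<^sup>2)"
    by (intro mult_left_mono) auto
  then show ?thesis by (simp add: pos_kernel_eq)
qed

lemma measurable_log_weight [measurable]: "log_weight \<in> borel_measurable borel"
  unfolding log_weight_def ln_plus_def by measurable

lemma log_weight_bounded_compact:
  assumes "compact K" "K \<subseteq> upper_half_plane"
  obtains C where "C \<ge> 0" "\<And>w. w \<in> K \<Longrightarrow> log_weight w \<le> C"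
proof -
  \<comment> \<open>Writing \<open>ln_plus t\<close> as \<open>ln (max 1 t)\<close> makes continuity
    evident; \<open>Im w\<close> does not vanish on \<open>K\<close>.\<close>
  have "continuous_on K (\<lambda>w. ln (max 1 (inverse (Im w))) + ln (max 1 (cmod w)))"
    using assms(2) by (intro continuous_intros) (auto simp: upper_half_plane_def)
  then have "bounded ((\<lambda>w. ln (max 1 (inverse (Im w))) + ln (max 1 (cmod w))) ` K)"
    by (intro compact_imp_bounded compact_continuous_image assms)
  then obtain C where "\<forall>x\<in>(\<lambda>w. ln (max 1 (inverse (Im w))) + ln (max 1 (cmod w))) ` K. \<bar>x\<bar> \<le> C"
    unfolding bounded_real by blast
  then have C: "\<bar>log_weight w\<bar> \<le> C" if "w \<in> K" for w
    using that by (simp add: ln_max_1 log_weight_def)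
  show ?thesis
  proof (rule that)
    show "max C 0 \<ge> 0" by simp
    show "log_weight w \<le> max C 0" if "w \<in> K" for w
      using C[OF that] by linarith
  qed
qed

text \<open>The role of \<open>g\<close> is that of a Borel representative of \<open>f\<close>
  extended by zero, for which product measurability and Fubini over \<open>lborel\<close> are
  available.\<close>

locale half_plane_function =
  fixes g :: "complex \<Rightarrow> complex"
  assumes integrable: "integrable lborel g"
    and support: "w \<notin> upper_half_plane \<Longrightarrow> g w = 0"
begin

lemma measurable_g [measurable]: "g \<in> borel_measurable borel"
  using borel_measurable_integrable[OF integrable] by simp

lemma support_Im: "\<not> Im w > 0 \<Longrightarrow> g w = 0"
  using support by (simp add: upper_half_plane_def)

lemma integrable_kernel_mult:
  assumes [measurable]: "case_prod \<kappa> \<in> borel_measurable (borel \<Otimes>\<^sub>M borel)"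
    and bound: "\<And>z w. cmod (\<kappa> z w) \<le> pos_kernel z w"
    and z: "Im z > 0"
  shows "integrable lborel (\<lambda>w. \<kappa> z w * g w)"
proof (rule Bochner_Integration.integrable_bound)
  show "integrable lborel (\<lambda>w. 1 / (pi * (Im z)\<^sup>2) * cmod (g w))"
    using integrable by simp
  show "AE w in lborel. norm (\<kappa> z w * g w) \<le> norm (1 / (pi * (Im z)\<^sup>2) * cmod (g w))"
  proof (intro AE_I2)
    fix w
    have "cmod (\<kappa> z w) * cmod (g w) \<le> 1 / (pi * (Im z)\<^sup>2) * cmod (g w)"
    proof (cases "Im w > 0")
      case True
      then show ?thesis
        by (intro mult_right_mono order_trans[OF bound pos_kernel_le[OF z]]) auto
    qed (simp add: support_Im)
    then show "norm (\<kappa> z w * g w) \<le> norm (1 / (pi * (Im z)\<^sup>2) * cmod (g w))"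
      by (simp add: norm_mult)
  qed
qed measurable

text \<open>Both \<open>bergman_kernel\<close> and its modulus satisfy \<open>bound\<close> and
  \<open>diff\<close>. The mean-zero condition permits subtracting the kernel at
  \<open>\<i>\<close>, and Tonelli reduces the claim to
  \<open>nn_integral_kernel_diff\<close>.\<close>

lemma integrable_kernel_proj:
  assumes [measurable]: "case_prod \<kappa> \<in> borel_measurable (borel \<Otimes>\<^sub>M borel)"
    and bound: "\<And>z w. cmod (\<kappa> z w) \<le> pos_kernel z w"
    and diff: "\<And>z w. cmod (\<kappa> z w - \<kappa> z \<i>) \<le> kernel_diff z w"
    and mean: "(\<integral> w. g w \<partial>lborel) = 0"
    and moment: "(\<integral>\<^sup>+ w. ennreal (cmod (g w) * log_weight w) \<partial>lborel) < \<infinity>"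
  shows "integrable lborel (\<lambda>z. indicator upper_half_plane z *\<^sub>R kernel_proj \<kappa> g z)"
proof (rule integrableI_bounded)
  show "(\<lambda>z. indicator upper_half_plane z *\<^sub>R kernel_proj \<kappa> g z) \<in> borel_measurable lborel"
    unfolding kernel_proj_def by measurable
  have le: "ennreal (norm (indicator upper_half_plane z *\<^sub>R kernel_proj \<kappa> g z))
    \<le> (\<integral>\<^sup>+ w. indicator upper_half_plane z * ennreal (kernel_diff z w) * ennreal (cmod (g w)) \<partial>lborel)" for z
  proof (cases "z \<in> upper_half_plane")
    case True
    then have z: "Im z > 0" by (simp add: upper_half_plane_def)
    have "kernel_proj \<kappa> g z = (\<integral> w. \<kappa> z w * g w \<partial>lborel) - (\<integral> w. \<kappa> z \<i> * g w \<partial>lborel)"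
      by (simp add: kernel_proj_def mean)
    also have "\<dots> = (\<integral> w. \<kappa> z w * g w - \<kappa> z \<i> * g w \<partial>lborel)"
      using integrable_kernel_mult[OF assms(1) bound z] integrable
      by (intro Bochner_Integration.integral_diff[symmetric]) auto
    also have "ennreal (norm \<dots>) \<le> (\<integral>\<^sup>+ w. ennreal (norm (\<kappa> z w * g w - \<kappa> z \<i> * g w)) \<partial>lborel)"
      using integrable_kernel_mult[OF assms(1) bound z] integrable
      by (intro integral_norm_bound_ennreal) auto
    also have "\<dots> \<le> (\<integral>\<^sup>+ w. ennreal (kernel_diff z w) * ennreal (cmod (g w)) \<partial>lborel)"
      using diff by (intro nn_integral_mono)
        (auto simp: ennreal_mult[symmetric] left_diff_distrib[symmetric] norm_mult
          intro!: ennreal_leI mult_right_mono)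
    finally show ?thesis using True by simp
  qed simp
  have "(\<integral>\<^sup>+ z. ennreal (norm (indicator upper_half_plane z *\<^sub>R kernel_proj \<kappa> g z)) \<partial>lborel)
    \<le> (\<integral>\<^sup>+ z. \<integral>\<^sup>+ w. indicator upper_half_plane z * ennreal (kernel_diff z w) * ennreal (cmod (g w)) \<partial>lborel \<partial>lborel)"
    by (rule nn_integral_mono) (rule le)
  also have "\<dots> = (\<integral>\<^sup>+ w. \<integral>\<^sup>+ z. indicator upper_half_plane z * ennreal (kernel_diff z w) * ennreal (cmod (g w)) \<partial>lborel \<partial>lborel)"
    by (rule lborel_pair.Fubini') measurable
  also have "\<dots> = (\<integral>\<^sup>+ w. (\<integral>\<^sup>+ z. indicator upper_half_plane z * ennreal (kernel_diff z w) \<partial>lborel) * ennreal (cmod (g w)) \<partial>lborel)"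
    by (intro nn_integral_cong nn_integral_multc) measurable
  also have "\<dots> \<le> (\<integral>\<^sup>+ w. 26 * ennreal (cmod (g w)) + 26 * ennreal (cmod (g w) * log_weight w) \<partial>lborel)"
  proof (intro nn_integral_mono)
    fix w
    show "(\<integral>\<^sup>+ z. indicator upper_half_plane z * ennreal (kernel_diff z w) \<partial>lborel) * ennreal (cmod (g w))
      \<le> 26 * ennreal (cmod (g w)) + 26 * ennreal (cmod (g w) * log_weight w)"
    proof (cases "Im w > 0")
      case True
      have "(\<integral>\<^sup>+ z. indicator upper_half_plane z * ennreal (kernel_diff z w) \<partial>lborel) * ennreal (cmod (g w))
        \<le> ennreal (26 * (1 + log_weight w)) * ennreal (cmod (g w))"
        by (intro mult_right_mono nn_integral_kernel_diff True) simp
      also have "\<dots> = ennreal (26 * cmod (g w) + 26 * (cmod (g w) * log_weight w))"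
        by (simp add: ennreal_mult[symmetric] algebra_simps del: ennreal_plus)
      also have "\<dots> = 26 * ennreal (cmod (g w)) + 26 * ennreal (cmod (g w) * log_weight w)"
        by (simp add: ennreal_mult)
      finally show ?thesis .
    qed (simp add: support_Im)
  qed
  also have "\<dots> = 26 * (\<integral>\<^sup>+ w. ennreal (cmod (g w)) \<partial>lborel) + 26 * (\<integral>\<^sup>+ w. ennreal (cmod (g w) * log_weight w) \<partial>lborel)"
    by (simp add: nn_integral_add nn_integral_cmult)
  also have "\<dots> < \<infinity>"
    using moment integrable by (simp add: integrable_iff_bounded ennreal_mult_less_top)
  finally show "(\<integral>\<^sup>+ z. ennreal (norm (indicator upper_half_plane z *\<^sub>R kernel_proj \<kappa> g z)) \<partial>lborel) < \<infinity>" .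
qed

section \<open>Testing P^+ on strips and the vanishing of the mean\<close>

abbreviation P_pos :: "complex \<Rightarrow> complex" where
  "P_pos \<equiv> kernel_proj (\<lambda>z w. of_real (pos_kernel z w)) g"

text \<open>Fubini's theorem: as the mass bound \<open>ln (b / a)\<close> is uniform in
  \<open>w\<close> and \<open>g\<close> is integrable, the double integrand is absolutely integrable
  on the product.\<close>

lemma
  assumes E [measurable]: "E \<in> sets borel" and sub: "E \<subseteq> strip a b" and ab: "0 < a" "a \<le> b"
  shows integrable_kernel_mass_mult: "integrable lborel (\<lambda>w. kernel_mass E w *\<^sub>R g w)"
    and integral_kernel_mass_mult:
      "(\<integral> w. kernel_mass E w *\<^sub>R g w \<partial>lborel) = (\<integral> z. indicator E z *\<^sub>R P_pos z \<partial>lborel)"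
    and integrable_indicator_P_pos: "integrable lborel (\<lambda>z. indicator E z *\<^sub>R P_pos z)"
proof -
  define f where "f z w = indicator E z *\<^sub>R (of_real (pos_kernel z w) * g w)" for z w
  have f_meas [measurable]: "case_prod f \<in> borel_measurable (lborel \<Otimes>\<^sub>M lborel)"
    unfolding f_def by measurable
  have f_snd: "(\<integral> z. f z w \<partial>lborel) = kernel_mass E w *\<^sub>R g w" for w
  proof (cases "Im w > 0")
    case True
    have "(\<integral> z. f z w \<partial>lborel) = (\<integral> z. (indicator E z * pos_kernel z w) *\<^sub>R g w \<partial>lborel)"
      by (simp add: f_def scaleR_conv_of_real mult_ac)
    also have "\<dots> = kernel_mass E w *\<^sub>R g w"
      unfolding kernel_mass_def
      by (rule integral_scaleR_left) (rule integrable_kernel_mass[OF E sub ab True])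
    finally show ?thesis .
  qed (simp add: f_def support_Im)
  have f_fst: "(\<integral> w. f z w \<partial>lborel) = indicator E z *\<^sub>R P_pos z" for z
    by (simp add: f_def kernel_proj_def)
  have "integrable (lborel \<Otimes>\<^sub>M lborel) (case_prod f)"
  proof (rule integrableI_bounded)
    have "(\<integral>\<^sup>+ p. ennreal (norm (case_prod f p)) \<partial>(lborel \<Otimes>\<^sub>M lborel))
      = (\<integral>\<^sup>+ w. \<integral>\<^sup>+ z. ennreal (norm (f z w)) \<partial>lborel \<partial>lborel)"
      by (subst lborel_pair.nn_integral_snd[symmetric]) auto
    also have "\<dots> \<le> (\<integral>\<^sup>+ w. ennreal (ln (b / a)) * ennreal (cmod (g w)) \<partial>lborel)"
    proof (intro nn_integral_mono)
      fix w
      show "(\<integral>\<^sup>+ z. ennreal (norm (f z w)) \<partial>lborel) \<le> ennreal (ln (b / a)) * ennreal (cmod (g w))"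
      proof (cases "Im w > 0")
        case True
        have "(\<integral>\<^sup>+ z. ennreal (norm (f z w)) \<partial>lborel)
          = (\<integral>\<^sup>+ z. indicator E z * ennreal (pos_kernel z w) * ennreal (cmod (g w)) \<partial>lborel)"
          by (intro nn_integral_cong) (simp add: f_def norm_mult ennreal_mult indicator_def)
        also have "\<dots> = ennreal (kernel_mass E w) * ennreal (cmod (g w))"
          unfolding ennreal_kernel_mass[OF E sub ab True] by (rule nn_integral_multc) measurable
        also have "\<dots> \<le> ennreal (ln (b / a)) * ennreal (cmod (g w))"
          by (intro mult_right_mono ennreal_leI kernel_mass_le[OF E sub ab True]) simp
        finally show ?thesis .
      qed (simp add: f_def support_Im)
    qed
    also have "\<dots> < \<infinity>"
      using integrable by (simp add: nn_integral_cmult integrable_iff_bounded ennreal_mult_less_top)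
    finally show "(\<integral>\<^sup>+ p. ennreal (norm (case_prod f p)) \<partial>(lborel \<Otimes>\<^sub>M lborel)) < \<infinity>" .
  qed measurable
  from lborel_pair.integrable_snd[OF this] lborel_pair.integrable_fst[OF this] lborel_pair.Fubini_integral[OF this]
  show "integrable lborel (\<lambda>w. kernel_mass E w *\<^sub>R g w)"
    "integrable lborel (\<lambda>z. indicator E z *\<^sub>R P_pos z)"
    "(\<integral> w. kernel_mass E w *\<^sub>R g w \<partial>lborel) = (\<integral> z. indicator E z *\<^sub>R P_pos z \<partial>lborel)"
    by (simp_all add: f_snd f_fst)
qed

definition P_pos_norm :: real where
  "P_pos_norm = (\<integral> z. norm (indicator upper_half_plane z *\<^sub>R P_pos z) \<partial>lborel)"

lemma norm_integral_kernel_mass_mult_le: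
  assumes P: "integrable lborel (\<lambda>z. indicator upper_half_plane z *\<^sub>R P_pos z)"
    and E: "E \<in> sets borel" "E \<subseteq> strip a b" "0 < a" "a \<le> b"
  shows "norm (\<integral> w. kernel_mass E w *\<^sub>R g w \<partial>lborel) \<le> P_pos_norm"
proof -
  have "norm (\<integral> w. kernel_mass E w *\<^sub>R g w \<partial>lborel) \<le> (\<integral> z. norm (indicator E z *\<^sub>R P_pos z) \<partial>lborel)"
    unfolding integral_kernel_mass_mult[OF E] by (rule integral_norm_bound)
  also have "\<dots> \<le> P_pos_norm"
    unfolding P_pos_norm_def
  proof (rule integral_mono)
    show "norm (indicator E z *\<^sub>R P_pos z) \<le> norm (indicator upper_half_plane z *\<^sub>R P_pos z)" for z
      using E by (force simp: indicator_def upper_half_plane_def)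
  qed (intro integrable_norm P integrable_indicator_P_pos[OF E])+
  finally show ?thesis .
qed

text \<open>The sequence \<open>X\<close> has two limits. Dominated convergence with majorant
  \<open>cmod (g w)\<close> gives the mean of \<open>g\<close>, while the bound
  \<open>P_pos_norm / ln (real n + 2)\<close> gives 0.\<close>

lemma mean_zero:
  assumes P: "integrable lborel (\<lambda>z. indicator upper_half_plane z *\<^sub>R P_pos z)"
  shows "(\<integral> w. g w \<partial>lborel) = 0"
proof (rule LIMSEQ_unique)
  \<comment> \<open>The shift by 2 keeps the logarithm in the denominator positive already for
    \<open>n = 0\<close>.\<close>
  define X where "X n = (\<integral> w. (kernel_mass (strip 1 (real n + 2)) w / ln (real n + 2)) *\<^sub>R g w \<partial>lborel)" for n :: nat
  show "X \<longlonglongrightarrow> (\<integral> w. g w \<partial>lborel)"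
    unfolding X_def
  proof (rule integral_dominated_convergence)
    show "integrable lborel (\<lambda>w. cmod (g w))"
      using integrable by simp
    show "AE w in lborel. (\<lambda>n. (kernel_mass (strip 1 (real n + 2)) w / ln (real n + 2)) *\<^sub>R g w) \<longlonglongrightarrow> g w"
    proof (intro AE_I2)
      fix w
      show "(\<lambda>n. (kernel_mass (strip 1 (real n + 2)) w / ln (real n + 2)) *\<^sub>R g w) \<longlonglongrightarrow> g w"
      proof (cases "Im w > 0")
        case True
        have "(\<lambda>n::nat. ln ((real n + 2 + Im w) / (1 + Im w)) / ln (real n + 2)) \<longlonglongrightarrow> 1"
          using True by real_asymp
        then have "(\<lambda>n. kernel_mass (strip 1 (real n + 2)) w / ln (real n + 2)) \<longlonglongrightarrow> 1"
          using True by (simp add: kernel_mass_strip del: atLeastAtMost_iff)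
        from tendsto_scaleR[OF this tendsto_const, of "g w"] show ?thesis by simp
      qed (simp add: support_Im)
    qed
    show "AE w in lborel. norm ((kernel_mass (strip 1 (real n + 2)) w / ln (real n + 2)) *\<^sub>R g w) \<le> cmod (g w)" for n
    proof (intro AE_I2)
      fix w
      have ln_pos: "ln (real n + 2) > 0" by simp
      have "kernel_mass (strip 1 (real n + 2)) w \<le> ln (real n + 2)" if "Im w > 0"
        using kernel_mass_le[of "strip 1 (real n + 2)" 1 "real n + 2" w] that by simp
      then have "\<bar>kernel_mass (strip 1 (real n + 2)) w / ln (real n + 2)\<bar> * cmod (g w) \<le> 1 * cmod (g w)"
        if "Im w > 0"
        using ln_pos that by (intro mult_right_mono) auto
      then show "norm ((kernel_mass (strip 1 (real n + 2)) w / ln (real n + 2)) *\<^sub>R g w) \<le> cmod (g w)"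
        unfolding norm_scaleR using support_Im[of w] by (cases "Im w > 0") auto
    qed
  qed measurable
  show "X \<longlonglongrightarrow> 0"
  proof (rule Lim_null_comparison)
    show "eventually (\<lambda>n. norm (X n) \<le> P_pos_norm / ln (real n + 2)) sequentially"
    proof (intro always_eventually allI)
      fix n :: nat
      have "X n = (1 / ln (real n + 2)) *\<^sub>R (\<integral> w. kernel_mass (strip 1 (real n + 2)) w *\<^sub>R g w \<partial>lborel)"
        unfolding X_def by (subst integral_scaleR_right[symmetric]) simp
      moreover have "norm (\<integral> w. kernel_mass (strip 1 (real n + 2)) w *\<^sub>R g w \<partial>lborel) \<le> P_pos_norm"
        by (rule norm_integral_kernel_mass_mult_le[OF P, where a = 1 and b = "real n + 2"]) auto
      ultimately show "norm (X n) \<le> P_pos_norm / ln (real n + 2)"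
        by (simp add: divide_right_mono)
    qed
    show "(\<lambda>n. P_pos_norm / ln (real n + 2)) \<longlonglongrightarrow> 0"
    proof -
      have "(\<lambda>n::nat. c / ln (real n + 2)) \<longlonglongrightarrow> 0" for c :: real
        by real_asymp
      then show ?thesis .
    qed
  qed
qed

text \<open>Off \<open>K\<close> the function equals its modulus, so a lower bound for the weight
  \<open>\<sigma> * (kernel_mass E w - kernel_mass E \<i>)\<close> yields an upper bound for a moment of \<open>cmod g\<close>;
  on \<open>K\<close> the weight is bounded uniformly in \<open>E\<close>.\<close>

lemma integral_off_compact_le:
  assumes P: "integrable lborel (\<lambda>z. indicator upper_half_plane z *\<^sub>R P_pos z)"
    and K [measurable]: "K \<in> sets borel"
    and C: "C \<ge> 0" "\<And>w. w \<in> K \<Longrightarrow> log_weight w \<le> C"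
    and nonneg: "AE w in lborel. w \<notin> K \<longrightarrow> g w \<in> \<real>\<^sub>\<ge>\<^sub>0"
    and E [measurable]: "E \<in> sets borel" and E': "E \<subseteq> strip a b" "0 < a" "a \<le> b"
    and \<sigma>: "\<bar>\<sigma>\<bar> = 1"
  defines "q \<equiv> \<lambda>w. \<sigma> * (kernel_mass E w - kernel_mass E \<i>)"
  shows "integrable lborel (\<lambda>w. indicator (- K) w * (cmod (g w) * q w))" (is ?int)
    and "(\<integral> w. indicator (- K) w * (cmod (g w) * q w) \<partial>lborel)
      \<le> P_pos_norm + 26 * (1 + C) * (\<integral> w. cmod (g w) \<partial>lborel)" (is ?le)
proof -
  note E_all = E E'
  have [measurable]: "q \<in> borel_measurable borel"
    unfolding q_def by measurable
  have q_eq: "q w *\<^sub>R g w = \<sigma> *\<^sub>R (kernel_mass E w *\<^sub>R g w) - (\<sigma> * kernel_mass E \<i>) *\<^sub>R g w" for w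
    by (simp add: q_def algebra_simps)
  have int_q: "integrable lborel (\<lambda>w. q w *\<^sub>R g w)"
    unfolding q_eq using integrable integrable_kernel_mass_mult[OF E_all]
    by (intro Bochner_Integration.integrable_diff integrable_scaleR_right)
  have "(\<integral> w. q w *\<^sub>R g w \<partial>lborel) = (\<integral> w. \<sigma> *\<^sub>R (kernel_mass E w *\<^sub>R g w) \<partial>lborel)
      - (\<integral> w. (\<sigma> * kernel_mass E \<i>) *\<^sub>R g w \<partial>lborel)"
    unfolding q_eq using integrable integrable_kernel_mass_mult[OF E_all]
    by (intro Bochner_Integration.integral_diff integrable_scaleR_right)
  \<comment> \<open>The constant \<open>kernel_mass E \<i>\<close>, which may grow with
    \<open>E\<close>, multiplies the mean of \<open>g\<close> and so drops out.\<close>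
  also have "\<dots> = \<sigma> *\<^sub>R (\<integral> w. kernel_mass E w *\<^sub>R g w \<partial>lborel)"
    unfolding integral_scaleR_right mean_zero[OF P] by simp
  finally have "(\<integral> w. q w *\<^sub>R g w \<partial>lborel) = \<sigma> *\<^sub>R (\<integral> w. kernel_mass E w *\<^sub>R g w \<partial>lborel)" .
  then have norm_q: "norm (\<integral> w. q w *\<^sub>R g w \<partial>lborel) \<le> P_pos_norm"
    using norm_integral_kernel_mass_mult_le[OF P E_all] \<sigma> by simp
  have int_K: "integrable lborel (\<lambda>w. indicator A w *\<^sub>R (q w *\<^sub>R g w))" if "A \<in> sets borel" for A
    using that int_q by (intro integrable_mult_indicator) auto
  have "(\<integral> w. q w *\<^sub>R g w \<partial>lborel)
    = (\<integral> w. indicator K w *\<^sub>R (q w *\<^sub>R g w) + indicator (- K) w *\<^sub>R (q w *\<^sub>R g w) \<partial>lborel)"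
    by (intro Bochner_Integration.integral_cong) (auto simp: indicator_def)
  also have "\<dots> = (\<integral> w. indicator K w *\<^sub>R (q w *\<^sub>R g w) \<partial>lborel) + (\<integral> w. indicator (- K) w *\<^sub>R (q w *\<^sub>R g w) \<partial>lborel)"
    by (intro Bochner_Integration.integral_add int_K) auto
  finally have split: "(\<integral> w. indicator (- K) w *\<^sub>R (q w *\<^sub>R g w) \<partial>lborel)
      = (\<integral> w. q w *\<^sub>R g w \<partial>lborel) - (\<integral> w. indicator K w *\<^sub>R (q w *\<^sub>R g w) \<partial>lborel)"
    by (simp add: algebra_simps)
  have "norm (\<integral> w. indicator K w *\<^sub>R (q w *\<^sub>R g w) \<partial>lborel)
      \<le> (\<integral> w. norm (indicator K w *\<^sub>R (q w *\<^sub>R g w)) \<partial>lborel)"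
    by (rule integral_norm_bound)
  also have "\<dots> \<le> (\<integral> w. 26 * (1 + C) * cmod (g w) \<partial>lborel)"
  proof (rule integral_mono)
    show "integrable lborel (\<lambda>w. norm (indicator K w *\<^sub>R (q w *\<^sub>R g w)))"
      by (intro integrable_norm int_K) simp
    show "integrable lborel (\<lambda>w. 26 * (1 + C) * cmod (g w))"
      using integrable by simp
    fix w
    show "norm (indicator K w *\<^sub>R (q w *\<^sub>R g w)) \<le> 26 * (1 + C) * cmod (g w)"
    proof (cases "Im w > 0 \<and> w \<in> K")
      case True
      then have "\<bar>q w\<bar> \<le> 26 * (1 + log_weight w)"
        using kernel_mass_diff_log_weight[OF E_all] \<sigma> by (simp add: q_def abs_mult)
      also have "\<dots> \<le> 26 * (1 + C)"
        using C True by simp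
      finally have "\<bar>q w\<bar> * cmod (g w) \<le> 26 * (1 + C) * cmod (g w)"
        by (rule mult_right_mono) simp
      then show ?thesis using True by simp
    next
      case False
      then show ?thesis using C support_Im by (auto simp: indicator_def)
    qed
  qed
  finally have norm_K: "norm (\<integral> w. indicator K w *\<^sub>R (q w *\<^sub>R g w) \<partial>lborel)
     \<le> 26 * (1 + C) * (\<integral> w. cmod (g w) \<partial>lborel)"
    by simp
  \<comment> \<open>Off \<open>K\<close> the value \<open>g w\<close> is a nonnegative real, so its
    real part is its modulus and the moment is the real part of an integral already
    controlled.\<close>
  have ae: "AE w in lborel. Re (indicator (- K) w *\<^sub>R (q w *\<^sub>R g w)) = indicator (- K) w * (cmod (g w) * q w)"
    using nonneg
  proof eventually_elim
    case (elim w)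
    then show ?case
      by (cases "w \<in> K") (auto elim!: nonneg_Reals_cases)
  qed
  have int_Re: "integrable lborel (\<lambda>w. Re (indicator (- K) w *\<^sub>R (q w *\<^sub>R g w)))"
    by (intro integrable_Re int_K) simp
  show ?int
    by (rule integrable_cong_AE_imp[OF int_Re _ ae]) measurable
  have "(\<integral> w. indicator (- K) w * (cmod (g w) * q w) \<partial>lborel)
     = (\<integral> w. Re (indicator (- K) w *\<^sub>R (q w *\<^sub>R g w)) \<partial>lborel)"
    by (rule integral_cong_AE[OF _ _ ae, symmetric]) measurable
  also have "\<dots> = Re (\<integral> w. indicator (- K) w *\<^sub>R (q w *\<^sub>R g w) \<partial>lborel)"
    by (intro integral_Re int_K) simp
  also have "\<dots> \<le> norm (\<integral> w. indicator (- K) w *\<^sub>R (q w *\<^sub>R g w) \<partial>lborel)"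
    by (rule complex_Re_le_cmod)
  also have "\<dots> \<le> P_pos_norm + 26 * (1 + C) * (\<integral> w. cmod (g w) \<partial>lborel)"
    unfolding split by (rule order_trans[OF norm_triangle_ineq4 add_mono[OF norm_q norm_K]])
  finally show ?le .
qed

section \<open>Fatou's lemma and finiteness of the logarithmic moment\<close>

text \<open>The Fatou argument common to the boundary and to infinity. The mass differences may
  change sign, so nonnegative minorants \<open>\<psi> n\<close> are used; as \<open>c\<close> and
  \<open>d\<close> do not depend on \<open>n\<close>, their integrals against
  \<open>cmod (g w)\<close> off \<open>K\<close> stay bounded.\<close>

lemma moment_off_compact_finite:
  assumes P: "integrable lborel (\<lambda>z. indicator upper_half_plane z *\<^sub>R P_pos z)"
    and K [measurable]: "K \<in> sets borel"
    and C: "C \<ge> 0" "\<And>w. w \<in> K \<Longrightarrow> log_weight w \<le> C"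
    and nonneg: "AE w in lborel. w \<notin> K \<longrightarrow> g w \<in> \<real>\<^sub>\<ge>\<^sub>0"
    and E: "\<And>n. E n \<in> sets borel" "\<And>n. E n \<subseteq> strip (a n) (b n)" "\<And>n. 0 < a n" "\<And>n. a n \<le> b n"
    and \<sigma>: "\<bar>\<sigma>\<bar> = 1"
    and \<psi>_meas [measurable]: "\<And>n::nat. \<psi> n \<in> borel_measurable borel"
    and \<psi>_nonneg: "\<And>n w. Im w > 0 \<Longrightarrow> 0 \<le> \<psi> n w"
    and \<psi>_le: "\<And>n w. Im w > 0 \<Longrightarrow> \<psi> n w \<le> c * (\<sigma> * (kernel_mass (E n) w - kernel_mass (E n) \<i>) + d)"
    and lim: "\<And>w. Im w > 0 \<Longrightarrow> (\<lambda>n. \<psi> n w) \<longlonglongrightarrow> \<psi>' w"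
    and c: "c \<ge> 0" and d: "d \<ge> 0"
  shows "(\<integral>\<^sup>+ w. indicator (- K) w * ennreal (cmod (g w) * \<psi>' w) \<partial>lborel) < \<infinity>"
proof -
  define N where "N = (\<integral> w. cmod (g w) \<partial>lborel)"
  define B where "B = c * (P_pos_norm + 26 * (1 + C) * N + d * N)"
  define q where "q n w = \<sigma> * (kernel_mass (E n) w - kernel_mass (E n) \<i>)" for n w
  define u where "u n w = indicator (- K) w * ennreal (cmod (g w) * \<psi> n w)" for n w
  have [measurable]: "u n \<in> borel_measurable borel" for n
    unfolding u_def by measurable
  have u_le: "(\<integral>\<^sup>+ w. u n w \<partial>lborel) \<le> ennreal B" for n
  proof -
    note off = integral_off_compact_le[OF P K C nonneg E(1)[of n] E(2-4) \<sigma>, folded q_def]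
    let ?h = "\<lambda>w. c * (indicator (- K) w * (cmod (g w) * q n w) + d * (indicator (- K) w * cmod (g w)))"
    have int_K: "integrable lborel (\<lambda>w. indicator (- K) w * cmod (g w))"
      using integrable_mult_indicator[of "- K" lborel "\<lambda>w. cmod (g w)"] integrable by simp
    have int: "integrable lborel ?h"
      using off(1) int_K by simp
    have h: "?h w = indicator (- K) w * (cmod (g w) * (c * (q n w + d)))" for w
      by (simp add: algebra_simps)
    have le: "indicator (- K) w * (cmod (g w) * \<psi> n w) \<le> ?h w"
      "0 \<le> indicator (- K) w * (cmod (g w) * \<psi> n w)" for w
      unfolding h using \<psi>_le[of w n] \<psi>_nonneg[of w n] support_Im[of w]
      by (cases "Im w > 0"; auto simp: indicator_def q_def intro!: mult_left_mono)+
    have "(\<integral>\<^sup>+ w. u n w \<partial>lborel) = (\<integral>\<^sup>+ w. ennreal (indicator (- K) w * (cmod (g w) * \<psi> n w)) \<partial>lborel)"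
      by (intro nn_integral_cong) (simp add: u_def indicator_def)
    also have "\<dots> \<le> (\<integral>\<^sup>+ w. ennreal (?h w) \<partial>lborel)"
      by (intro nn_integral_mono ennreal_leI le)
    also have "\<dots> = ennreal (\<integral> w. ?h w \<partial>lborel)"
      by (rule nn_integral_eq_integral[OF int]) (use le in \<open>auto intro: order_trans\<close>)
    also have "(\<integral> w. ?h w \<partial>lborel) = c * ((\<integral> w. indicator (- K) w * (cmod (g w) * q n w) \<partial>lborel)
        + d * (\<integral> w. indicator (- K) w * cmod (g w) \<partial>lborel))"
      using off(1) int_K by simp
    also have "\<dots> \<le> B"
    proof -
      have "(\<integral> w. indicator (- K) w * cmod (g w) \<partial>lborel) \<le> N"
        unfolding N_def using integrable int_K
        by (intro integral_mono) (auto simp: indicator_def)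
      then show ?thesis
        unfolding B_def using off(2) c d by (intro mult_left_mono add_mono) (auto simp: N_def)
    qed
    finally show ?thesis using ennreal_leI by blast
  qed
  have "(\<integral>\<^sup>+ w. indicator (- K) w * ennreal (cmod (g w) * \<psi>' w) \<partial>lborel) = (\<integral>\<^sup>+ w. liminf (\<lambda>n. u n w) \<partial>lborel)"
  proof (intro nn_integral_cong)
    fix w
    have "(\<lambda>n. u n w) \<longlonglongrightarrow> indicator (- K) w * ennreal (cmod (g w) * \<psi>' w)"
      unfolding u_def
    proof (cases "Im w > 0")
      case True
      have "(\<lambda>n. ennreal (cmod (g w) * \<psi> n w)) \<longlonglongrightarrow> ennreal (cmod (g w) * \<psi>' w)"
        by (intro tendsto_ennrealI tendsto_mult tendsto_const lim True)
      then show "(\<lambda>n. indicator (- K) w * ennreal (cmod (g w) * \<psi> n w)) \<longlonglongrightarrow> indicator (- K) w * ennreal (cmod (g w) * \<psi>' w)"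
        by (cases "w \<in> K") auto
    qed (simp add: support_Im)
    then show "indicator (- K) w * ennreal (cmod (g w) * \<psi>' w) = liminf (\<lambda>n. u n w)"
      by (rule lim_imp_Liminf[OF sequentially_bot, symmetric])
  qed
  also have "\<dots> \<le> liminf (\<lambda>n. \<integral>\<^sup>+ w. u n w \<partial>lborel)"
    by (rule nn_integral_liminf) simp
  also have "\<dots> \<le> liminf (\<lambda>n::nat. ennreal B)"
    by (intro Liminf_mono always_eventually allI u_le)
  also have "\<dots> < \<infinity>"
    by (simp add: Liminf_const)
  finally show ?thesis .
qed

lemma log_moment_finite:
  assumes P: "integrable lborel (\<lambda>z. indicator upper_half_plane z *\<^sub>R P_pos z)"
    and K: "compact K" "K \<subseteq> upper_half_plane"
    and nonneg: "AE w in lborel. w \<notin> K \<longrightarrow> g w \<in> \<real>\<^sub>\<ge>\<^sub>0"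
  shows "(\<integral>\<^sup>+ w. ennreal (cmod (g w) * log_weight w) \<partial>lborel) < \<infinity>"
proof -
  obtain C where C: "C \<ge> 0" "\<And>w. w \<in> K \<Longrightarrow> log_weight w \<le> C"
    using log_weight_bounded_compact[OF K] by metis
  have K_meas [measurable]: "K \<in> sets borel"
    using K(1) by (intro borel_closed compact_imp_closed)
  have [measurable]: "ln_plus \<in> borel_measurable borel"
    unfolding ln_plus_def by measurable
  \<comment> \<open>This is the limit, as \<open>e\<close> tends to 0, of the mass at
    \<open>w\<close> of the strip from \<open>e\<close> to 1.\<close>
  let ?v = "\<lambda>w. ln ((1 + Im w) / Im w)"
  \<comment> \<open>The choice \<open>d = 1\<close> absorbs the mass at \<open>\<i>\<close>, which
    is \<open>ln (2 / (e + 1))\<close> and stays below \<open>ln 2 < 1\<close> for all thin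
    strips.\<close>
  have boundary: "(\<integral>\<^sup>+ w. indicator (- K) w * ennreal (cmod (g w) * ?v w) \<partial>lborel) < \<infinity>"
  proof (rule moment_off_compact_finite[OF P K_meas C nonneg, where \<sigma> = 1 and c = 1 and d = 1
        and E = "\<lambda>n. strip (1 / (real n + 1)) 1" and a = "\<lambda>n. 1 / (real n + 1)" and b = "\<lambda>_. 1"
        and \<psi> = "\<lambda>n w. ln ((1 + Im w) / (1 / (real n + 1) + Im w))"])
    fix n :: nat and w assume w: "Im w > 0"
    have 1: "0 \<le> ln ((1 + Im w) / (e + Im w))"
      "ln ((1 + Im w) / (e + Im w)) \<le> kernel_mass (strip e 1) w - kernel_mass (strip e 1) \<i> + 1"
      if e: "0 < e" "e \<le> 1" for e
    proof -
      show "0 \<le> ln ((1 + Im w) / (e + Im w))"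
        using w e by (intro ln_ge_zero) (simp add: le_divide_eq_1)
      have "ln (2 / (e + 1)) \<le> ln 2"
        using e by (subst ln_le_cancel_iff) (auto simp: divide_le_eq)
      moreover have "kernel_mass (strip e 1) \<i> = ln (2 / (e + 1))"
        using kernel_mass_strip[OF e, of \<i>] by simp
      ultimately show "ln ((1 + Im w) / (e + Im w))
          \<le> kernel_mass (strip e 1) w - kernel_mass (strip e 1) \<i> + 1"
        using kernel_mass_strip[OF e w] ln_2_less_1 by linarith
    qed
    have e: "0 < 1 / (real n + 1)" "1 / (real n + 1) \<le> 1" by auto
    show "0 \<le> ln ((1 + Im w) / (1 / (real n + 1) + Im w))"
      by (rule 1(1)[OF e])
    show "ln ((1 + Im w) / (1 / (real n + 1) + Im w)) \<le> 1 * (1 *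
        (kernel_mass (strip (1 / (real n + 1)) 1) w - kernel_mass (strip (1 / (real n + 1)) 1) \<i>) + 1)"
      unfolding mult_1_left by (rule 1(2)[OF e])
    show "(\<lambda>n. ln ((1 + Im w) / (1 / (real n + 1) + Im w))) \<longlonglongrightarrow> ?v w"
      using w by real_asymp (simp add: divide_inverse)
  qed auto
  \<comment> \<open>The sign is negative because the sector has less mass at a distant
    \<open>w\<close> than at \<open>\<i>\<close>. The factor \<open>5 * pi / 2\<close> inverts the
    constant of \<open>kernel_mass_sector_diff\<close>, and 30 is its error term.\<close>
  have infinity: "(\<integral>\<^sup>+ w. indicator (- K) w * ennreal (cmod (g w) * ln (max 1 (cmod w))) \<partial>lborel) < \<infinity>"
  proof (rule moment_off_compact_finite[OF P K_meas C nonneg, where \<sigma> = "- 1" and c = "5 * pi / 2" and d = 30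
        and E = "\<lambda>n. sector (real n + 1)" and a = "\<lambda>_. 1" and b = "\<lambda>n. real n + 1"
        and \<psi> = "\<lambda>n w. ln (min (real n + 1) (max 1 (cmod w)))"])
    fix n :: nat and w assume w: "Im w > 0"
    show "0 \<le> ln (min (real n + 1) (max 1 (cmod w)))"
      by (intro ln_ge_zero) auto
    have "2 / (5 * pi) * ln (min (real n + 1) (max 1 (cmod w)))
        \<le> - 1 * (kernel_mass (sector (real n + 1)) w - kernel_mass (sector (real n + 1)) \<i>) + 30"
      using kernel_mass_sector_diff[of "real n + 1" w] w by simp
    then have "5 * pi / 2 * (2 / (5 * pi) * ln (min (real n + 1) (max 1 (cmod w)))) \<le> 5 * pi / 2 *
        (- 1 * (kernel_mass (sector (real n + 1)) w - kernel_mass (sector (real n + 1)) \<i>) + 30)"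
      by (intro mult_left_mono) auto
    then show "ln (min (real n + 1) (max 1 (cmod w))) \<le> 5 * pi / 2 *
        (- 1 * (kernel_mass (sector (real n + 1)) w - kernel_mass (sector (real n + 1)) \<i>) + 30)"
      by simp
    show "(\<lambda>n. ln (min (real n + 1) (max 1 (cmod w)))) \<longlonglongrightarrow> ln (max 1 (cmod w))"
    \<comment> \<open>Once \<open>real n + 1\<close> exceeds \<open>cmod w\<close> the truncation no
      longer acts, so the sequence is eventually constant.\<close>
    proof (rule tendsto_eventually)
      show "eventually (\<lambda>n. ln (min (real n + 1) (max 1 (cmod w))) = ln (max 1 (cmod w))) sequentially"
        using eventually_ge_at_top[of "nat \<lceil>cmod w\<rceil>"]
        by eventually_elim (auto simp: min_def)
    qed
  qed (use sector_subset_strip in auto)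
  have le: "ennreal (cmod (g w) * log_weight w)
    \<le> indicator (- K) w * ennreal (cmod (g w) * ?v w)
      + indicator (- K) w * ennreal (cmod (g w) * ln (max 1 (cmod w)))
      + ennreal (C * cmod (g w))" for w
  proof (cases "Im w > 0")
    case w: True
    show ?thesis
    proof (cases "w \<in> K")
      case True
      then show ?thesis
        using mult_left_mono[OF C(2), of w "cmod (g w)"] by (simp add: mult.commute ennreal_leI)
    next
      case False
      have "ln_plus (inverse (Im w)) = ln (max 1 (inverse (Im w)))"
        by (simp add: ln_max_1)
      \<comment> \<open>Both 1 and \<open>inverse (Im w)\<close> are at most
        \<open>(1 + Im w) / Im w\<close>.\<close>
      also have "\<dots> \<le> ?v w"
        using w by (subst ln_le_cancel_iff) (auto simp: field_simps)
      finally have v: "ln_plus (inverse (Im w)) \<le> ?v w" .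
      then have "0 \<le> ?v w"
        by (rule order_trans[OF ln_plus_nonneg])
      moreover have "log_weight w \<le> ?v w + ln (max 1 (cmod w))"
        using v by (simp add: log_weight_def ln_max_1)
      ultimately have "cmod (g w) * log_weight w \<le> cmod (g w) * ?v w + cmod (g w) * ln (max 1 (cmod w))"
        "0 \<le> cmod (g w) * ?v w" "0 \<le> cmod (g w) * ln (max 1 (cmod w))"
        by (auto simp: distrib_left[symmetric] intro: mult_left_mono)
      then have "ennreal (cmod (g w) * log_weight w)
        \<le> ennreal (cmod (g w) * ?v w) + ennreal (cmod (g w) * ln (max 1 (cmod w)))"
        by (simp only: ennreal_plus[symmetric] ennreal_leI)
      then show ?thesis
        using False by (simp add: add_increasing2)
    qed
  qed (simp add: support_Im)
  have "(\<integral>\<^sup>+ w. ennreal (cmod (g w) * log_weight w) \<partial>lborel)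
    \<le> (\<integral>\<^sup>+ w. indicator (- K) w * ennreal (cmod (g w) * ?v w)
      + indicator (- K) w * ennreal (cmod (g w) * ln (max 1 (cmod w)))
      + ennreal (C * cmod (g w)) \<partial>lborel)"
    by (rule nn_integral_mono) (rule le)
  also have "\<dots> = (\<integral>\<^sup>+ w. indicator (- K) w * ennreal (cmod (g w) * ?v w) \<partial>lborel)
      + (\<integral>\<^sup>+ w. indicator (- K) w * ennreal (cmod (g w) * ln (max 1 (cmod w))) \<partial>lborel)
      + (\<integral>\<^sup>+ w. ennreal (C * cmod (g w)) \<partial>lborel)"
    by (simp add: nn_integral_add)
  also have "\<dots> < \<infinity>"
  proof -
    have "(\<integral>\<^sup>+ w. ennreal (C * cmod (g w)) \<partial>lborel) < \<infinity>"
      using integrable C by (simp add: ennreal_mult nn_integral_cmult integrable_iff_bounded ennreal_mult_less_top)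
    then show ?thesis using boundary infinity by (simp del: atLeastAtMost_iff)
  qed
  finally show ?thesis .
qed

end

section \<open>Passage from Lebesgue to Borel functions and the theorem\<close>

lemma borel_representative:
  assumes "set_integrable lebesgue upper_half_plane f"
  obtains g :: "complex \<Rightarrow> complex"
  where "half_plane_function g"
    and "AE w in lebesgue. indicator upper_half_plane w *\<^sub>R f w = g w"
proof -
  let ?f = "\<lambda>w. indicator upper_half_plane w *\<^sub>R f w"
  have int: "integrable lebesgue ?f"
    using assms by (simp add: set_integrable_def)
  then have "?f \<in> borel_measurable lebesgue" by simp
  then have meas: "(\<lambda>w. Re (?f w)) \<in> borel_measurable lebesgue" "(\<lambda>w. Im (?f w)) \<in> borel_measurable lebesgue"
    by (rule measurable_Re_Im)+
  from completion_ex_borel_measurable_real[OF meas(1)] obtain r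
    where [measurable]: "r \<in> borel_measurable lborel" and r: "AE w in lborel. Re (?f w) = r w" ..
  from completion_ex_borel_measurable_real[OF meas(2)] obtain i
    where [measurable]: "i \<in> borel_measurable lborel" and i: "AE w in lborel. Im (?f w) = i w" ..
  \<comment> \<open>The indicator makes \<open>g\<close> vanish at every point off the half-plane,
    not merely at almost every one.\<close>
  define g where "g w = indicator upper_half_plane w *\<^sub>R (complex_of_real (r w) + \<i> * of_real (i w))" for w
  have g_meas [measurable]: "g \<in> borel_measurable lborel"
    unfolding g_def by measurable
  have "AE w in lborel. ?f w = g w"
    using r i by eventually_elim (auto simp: g_def complex_eq_iff indicator_def)
  then have eq: "AE w in lebesgue. ?f w = g w"
    by (rule AE_completion)
  have "integrable lebesgue g"
    by (rule integrable_cong_AE_imp[OF int measurable_completion[OF g_meas] eq])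
  then have "half_plane_function g"
    by (simp add: half_plane_function_def integrable_completion) (simp add: g_def)
  with eq show ?thesis by (intro that)
qed

text \<open>The integrands agree almost everywhere, so the identity persists when both Bochner
  integrals take their default value 0. It can therefore be applied at each point \<open>z\<close>
  of the plane, with \<open>k\<close> the kernel at that \<open>z\<close>.\<close>

lemma lebesgue_integral_kernel_eq:
  fixes f g k :: "complex \<Rightarrow> complex"
  assumes f: "set_integrable lebesgue upper_half_plane f"
    and [measurable]: "g \<in> borel_measurable borel" "k \<in> borel_measurable borel"
    and eq: "AE w in lebesgue. indicator upper_half_plane w *\<^sub>R f w = g w"
  shows "(LINT w:upper_half_plane|lebesgue. k w * f w) = (\<integral> w. k w * g w \<partial>lborel)"
proof -
  have "(\<lambda>w. indicator upper_half_plane w *\<^sub>R f w) \<in> borel_measurable lebesgue"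
    using f unfolding set_integrable_def by (rule borel_measurable_integrable)
  moreover have k: "k \<in> borel_measurable lebesgue"
    by (rule measurable_completion) simp
  ultimately have "(\<lambda>w. k w * (indicator upper_half_plane w *\<^sub>R f w)) \<in> borel_measurable lebesgue"
    by (rule borel_measurable_times[rotated])
  moreover have kg: "(\<lambda>w. k w * g w) \<in> borel_measurable lborel"
    by measurable
  moreover have "AE w in lebesgue. k w * (indicator upper_half_plane w *\<^sub>R f w) = k w * g w"
    using eq by eventually_elim simp
  ultimately have "(\<integral> w. k w * (indicator upper_half_plane w *\<^sub>R f w) \<partial>lebesgue) = (\<integral> w. k w * g w \<partial>lebesgue)"
    by (intro integral_cong_AE) (auto intro: measurable_completion)
  then show ?thesis
    using kg by (simp add: set_lebesgue_integral_def integral_completion)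
qed

theorem theorem2:
  fixes f :: "complex \<Rightarrow> complex"
  assumes "set_integrable lebesgue upper_half_plane f"
  shows "((LINT z:upper_half_plane|lebesgue. f z) = 0 \<and> log_moment f < \<infinity> \<longrightarrow>
            set_integrable lebesgue upper_half_plane (bergman_proj f) \<and>
            set_integrable lebesgue upper_half_plane (bergman_proj_pos f)) \<and>
         ((\<exists>K. compact K \<and> K \<subseteq> upper_half_plane \<and>
              (AE z in lebesgue. z \<in> upper_half_plane - K \<longrightarrow> f z \<in> \<real>\<^sub>\<ge>\<^sub>0)) \<and>
          set_integrable lebesgue upper_half_plane (bergman_proj_pos f) \<longrightarrow>
            (LINT z:upper_half_plane|lebesgue. f z) = 0 \<and> log_moment f < \<infinity>)"
proof -
  obtain g where "half_plane_function g"
    and eq: "AE w in lebesgue. indicator upper_half_plane w *\<^sub>R f w = g w"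
    using borel_representative[OF assms] .
  then interpret half_plane_function g by simp
  note kernel_eq = lebesgue_integral_kernel_eq[OF assms measurable_g _ eq]
  have mean: "(LINT z:upper_half_plane|lebesgue. f z) = (\<integral> w. g w \<partial>lborel)"
    using kernel_eq[of "\<lambda>_. 1"] by simp
  have "log_moment f = (\<integral>\<^sup>+ w. ennreal (cmod (g w) * log_weight w) \<partial>lebesgue)"
    unfolding log_moment_def
  proof (rule nn_integral_cong_AE)
    show "AE w in lebesgue. ennreal (cmod (f w) * (ln_plus (inverse (Im w)) + ln_plus (cmod w)))
        * indicator upper_half_plane w = ennreal (cmod (g w) * log_weight w)"
      using eq
    proof eventually_elim
      case (elim w)
      then show ?case
        by (cases "w \<in> upper_half_plane") (auto simp: log_weight_def)
    qed
  qed
  then have moment: "log_moment f = (\<integral>\<^sup>+ w. ennreal (cmod (g w) * log_weight w) \<partial>lborel)"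
    by (simp add: nn_integral_completion)
  have "bergman_proj f z = kernel_proj bergman_kernel g z" for z
    unfolding bergman_proj_def kernel_proj_def by (rule kernel_eq) measurable
  then have proj: "set_integrable lebesgue upper_half_plane (bergman_proj f)
    \<longleftrightarrow> integrable lborel (\<lambda>z. indicator upper_half_plane z *\<^sub>R kernel_proj bergman_kernel g z)"
    unfolding set_integrable_def by (subst integrable_completion[symmetric]) (auto simp: kernel_proj_def)
  have "bergman_proj_pos f z = P_pos z" for z
    unfolding bergman_proj_pos_def kernel_proj_def pos_kernel_def[symmetric] by (rule kernel_eq) measurable
  then have proj_pos: "set_integrable lebesgue upper_half_plane (bergman_proj_pos f)
    \<longleftrightarrow> integrable lborel (\<lambda>z. indicator upper_half_plane z *\<^sub>R P_pos z)"
    unfolding set_integrable_def by (subst integrable_completion[symmetric]) (auto simp: kernel_proj_def)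
  show ?thesis
    unfolding mean moment proj proj_pos
  proof (intro conjI impI; elim conjE exE)
    assume "(\<integral> w. g w \<partial>lborel) = 0" "(\<integral>\<^sup>+ w. ennreal (cmod (g w) * log_weight w) \<partial>lborel) < \<infinity>"
    note mean_moment = this
    show "integrable lborel (\<lambda>z. indicator upper_half_plane z *\<^sub>R kernel_proj bergman_kernel g z)"
      by (rule integrable_kernel_proj[OF _ _ _ mean_moment]) (auto simp: pos_kernel_def kernel_diff_def)
    show "integrable lborel (\<lambda>z. indicator upper_half_plane z *\<^sub>R P_pos z)"
    proof (rule integrable_kernel_proj[OF _ _ _ mean_moment])
      show "cmod (of_real (pos_kernel z w) - of_real (pos_kernel z \<i>)) \<le> kernel_diff z w" for z w
        unfolding of_real_diff[symmetric] norm_of_real pos_kernel_def kernel_diff_def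
        by (rule norm_triangle_ineq3)
    qed auto
  next
    fix K
    assume P: "integrable lborel (\<lambda>z. indicator upper_half_plane z *\<^sub>R P_pos z)"
      and K: "compact K" "K \<subseteq> upper_half_plane"
      and nonneg: "AE z in lebesgue. z \<in> upper_half_plane - K \<longrightarrow> f z \<in> \<real>\<^sub>\<ge>\<^sub>0"
    show "(\<integral> w. g w \<partial>lborel) = 0"
      by (rule mean_zero[OF P])
    \<comment> \<open>Off the half-plane \<open>g w = 0\<close>, a nonnegative real, which extends
      the sign condition to the full complement of \<open>K\<close>.\<close>
    have "AE w in lebesgue. w \<notin> K \<longrightarrow> g w \<in> \<real>\<^sub>\<ge>\<^sub>0"
      using nonneg eq
    proof eventually_elim
      case (elim w)
      then show ?case
        by (cases "w \<in> upper_half_plane") auto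
    qed
    then have "AE w in lborel. w \<notin> K \<longrightarrow> g w \<in> \<real>\<^sub>\<ge>\<^sub>0"
      by (simp add: AE_completion_iff)
    then show "(\<integral>\<^sup>+ w. ennreal (cmod (g w) * log_weight w) \<partial>lborel) < \<infinity>"
      by (rule log_moment_finite[OF P K])
  qed
qed

end
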